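(* Let $r \geq 1$ and $e \geq 0$ be integers and let $\mathsf{s}=(s_1,\dots,s_r)\in\mathbb{Z}^r$. Assume that $r = 1$ or $(r,e)\in\{(2,2),(2,3),(3,2)\}$. Then $$Q^{\mathsf{s}} = \bigl\{\alpha\in Q : \mathsf{w}^{\mathsf{s}}(\alpha)\geq 0\bigr\}.$$
   Context: For $e=0$ we have $\mathbb{Z}/e\mathbb{Z}=\mathbb{Z}$. A partition is a finite non-increasing sequence $\lambda = (\lambda_1\geq\dots\geq\lambda_h>0)$ of positive integers (possibly empty), with Young diagram $\{(a,b): 1\le a\le h,\ 1\le b\le \lambda_a\}$. An $r$-partition is an $r$-tuple $\boldsymbol\lambda=(\lambda^{(1)},\dots,\lambda^{(r)})$ of partitions; its nodes are the triples $(a,b,j)$ with $j\in\{1,\dots,r\}$ and $(a,b)$ in the Young diagram of $\lambda^{(j)}$. For a multicharge $\mathsf{s}=(s_1,\dots,s_r)\in\mathbb{Z}^r$, the $\mathsf{s}$-residue of $(a,b,j)$ is $b-a+s_j \bmod e \in\mathbb{Z}/e\mathbb{Z}$, and $c_i^{\mathsf{s}}(\boldsymbol\lambda)$ is the number of nodes of $\boldsymbol\lambda$ of $\mathsf{s}$-residue $i$. $Q=\bigoplus_{i\in\mathbb{Z}/e\mathbb{Z}}\mathbb{Z}\alpha_i$ is the free abelian group with basis $(\alpha_i)_{i\in\mathbb{Z}/e\mathbb{Z}}$ (so elements have finite support when $e=0$). Set $\alpha^{\mathsf{s}}(\boldsymbol\lambda):=\sum_{i}c_i^{\mathsf{s}}(\boldsymbol\lambda)\alpha_i\in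 Q$ and $Q^{\mathsf{s}}:=\{\alpha^{\mathsf{s}}(\boldsymbol\lambda):\boldsymbol\lambda\text{ an }r\text{-partition}\}$. For $\alpha=\sum_i c_i\alpha_i\in Q$, its $\mathsf{s}$-weight is $\mathsf{w}^{\mathsf{s}}(\alpha):=\sum_{j=1}^r c_{s_j}-\frac12\sum_{i\in\mathbb{Z}/e\mathbb{Z}}(c_i-c_{i+1})^2\in\mathbb{Z}$, where the index $s_j$ is read modulo $e$. *)

theory Defs
  imports "HOL-Algebra.Elementary_Groups" "HOL-Algebra.Free_Abelian_Groups"
begin

definition is_partition :: "nat list \<Rightarrow> bool" where
  "is_partition p \<longleftrightarrow> sorted_wrt (\<ge>) p \<and> (\<forall>x\<in>set p. x > 0)"

definition multipartitions :: "nat \<Rightarrow> nat list list set" where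
  "multipartitions r = {l. length l = r \<and> (\<forall>p\<in>set l. is_partition p)}"

text \<open>Rows, columns and components are numbered from 1, lists from 0.\<close>

definition young_diagram :: "nat list \<Rightarrow> (nat \<times> nat) set" where
  "young_diagram p = {(a, b). a \<in> {1..length p} \<and> b \<in> {1..p ! (a - 1)}}"

definition nodes :: "nat list list \<Rightarrow> (nat \<times> nat \<times> nat) set" where
  "nodes l = {(a, b, j). j \<in> {1..length l} \<and> (a, b) \<in> young_diagram (l ! (j - 1))}"

text \<open>
  The index set Z/eZ is represented by \<open>carrier (integer_mod_group e)\<close>, which is
  \<open>UNIV\<close> for \<open>e = 0\<close> and \<open>{0..<int e}\<close> otherwise. The class of an integer \<open>x\<close>
  is \<open>x mod int e\<close>, which is \<open>x\<close> itself for \<open>e = 0\<close>.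
\<close>

abbreviation residues_mod :: "nat \<Rightarrow> int set" where
  "residues_mod e \<equiv> carrier (integer_mod_group e)"

definition node_residue :: "nat \<Rightarrow> int list \<Rightarrow> nat \<times> nat \<times> nat \<Rightarrow> int" where
  "node_residue e s = (\<lambda>(a, b, j). (int b - int a + s ! (j - 1)) mod int e)"

definition residue_count :: "nat \<Rightarrow> int list \<Rightarrow> nat list list \<Rightarrow> int \<Rightarrow> nat" where
  "residue_count e s l i = card {n \<in> nodes l. node_residue e s n = i}"

abbreviation root_lattice :: "nat \<Rightarrow> (int \<Rightarrow>\<^sub>0 int) set" where
  "root_lattice e \<equiv> carrier (free_Abelian_group (residues_mod e))"

text \<open>
  A sum over an infinite set is 0 by convention, so for the sake of \<open>e = 0\<close> the sums over
  Z/eZ below are restricted to the (finitely many) indices of nonzero terms.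
\<close>

definition root_of :: "nat \<Rightarrow> int list \<Rightarrow> nat list list \<Rightarrow> (int \<Rightarrow>\<^sub>0 int)" where
  "root_of e s l = (\<Sum>i | i \<in> residues_mod e \<and> residue_count e s l i \<noteq> 0.
     frag_cmul (int (residue_count e s l i)) (frag_of i))"

definition root_set :: "nat \<Rightarrow> int list \<Rightarrow> (int \<Rightarrow>\<^sub>0 int) set" where
  "root_set e s = root_of e s ` multipartitions (length s)"

definition diff_square_sum :: "nat \<Rightarrow> (int \<Rightarrow>\<^sub>0 int) \<Rightarrow> int" where
  "diff_square_sum e \<alpha> =
     (let c = Poly_Mapping.lookup \<alpha> in
      \<Sum>i | i \<in> residues_mod e \<and> c i \<noteq> c ((i + 1) mod int e). (c i - c ((i + 1) mod int e))\<^sup>2)"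

text \<open>The integer division by 2 is exact on the root lattice, see \<open>even_diff_square_sum\<close> below.\<close>

definition weight :: "nat \<Rightarrow> int list \<Rightarrow> (int \<Rightarrow>\<^sub>0 int) \<Rightarrow> int" where
  "weight e s \<alpha> =
     (\<Sum>j\<in>{1..length s}. Poly_Mapping.lookup \<alpha> ((s ! (j - 1)) mod int e)) - diff_square_sum e \<alpha> div 2"

lemma finite_nodes: "finite (nodes l)"
proof -
  have "nodes l \<subseteq> (\<lambda>(j, a, b). (a, b, j)) `
      (SIGMA j:{1..length l}. SIGMA a:{1..length (l ! (j - 1))}. {1..l ! (j - 1) ! (a - 1)})"
    by (force simp: nodes_def young_diagram_def)
  then show ?thesis
    by (rule finite_subset) auto
qed

lemma mod_in_residues_mod: "x mod int e \<in> residues_mod e"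
  by (auto simp: carrier_integer_mod_group)

lemma finite_residue_count: "finite {i \<in> residues_mod e. residue_count e s l i \<noteq> 0}"
proof -
  have "{i \<in> residues_mod e. residue_count e s l i \<noteq> 0} \<subseteq> node_residue e s ` nodes l"
    by (auto simp: residue_count_def dest!: card_gt_0_iff[THEN iffD1])
  then show ?thesis
    using finite_nodes finite_subset by blast
qed

lemma residue_count_outside:
  assumes "i \<notin> residues_mod e"
  shows "residue_count e s l i = 0"
proof -
  have "node_residue e s n \<in> residues_mod e" for n
    unfolding node_residue_def by (cases n) (simp only: split_conv mod_in_residues_mod)
  then have "{n \<in> nodes l. node_residue e s n = i} = {}"
    using assms by blast
  then show ?thesis
    by (simp only: residue_count_def card.empty)
qed

lemma lookup_root_of: "Poly_Mapping.lookup (root_of e s l) i = int (residue_count e s l i)"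
proof -
  let ?I = "{i \<in> residues_mod e. residue_count e s l i \<noteq> 0}"
  have "Poly_Mapping.lookup (root_of e s l) i =
      (\<Sum>k\<in>?I. if i = k then int (residue_count e s l k) else 0)"
    unfolding root_of_def lookup_sum by (intro sum.cong) auto
  also have "\<dots> = int (residue_count e s l i)"
    using finite_residue_count[of e s l] residue_count_outside[of i e s l] by auto
  finally show ?thesis .
qed

lemma root_of_in_root_lattice: "root_of e s l \<in> root_lattice e"
proof -
  have "i \<in> residues_mod e" if "i \<in> Poly_Mapping.keys (root_of e s l)" for i
  proof (rule ccontr)
    assume "i \<notin> residues_mod e"
    then have "Poly_Mapping.lookup (root_of e s l) i = 0"
      using residue_count_outside[of i e s l] by (simp add: lookup_root_of)
    then show False
      using that by (simp only: in_keys_iff)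
  qed
  then show ?thesis
    unfolding carrier_free_Abelian_group_iff by blast
qed

lemma finite_diff_support:
  assumes "\<alpha> \<in> root_lattice e"
  shows "finite {i \<in> residues_mod e.
    Poly_Mapping.lookup \<alpha> i \<noteq> Poly_Mapping.lookup \<alpha> ((i + 1) mod int e)}"
proof (cases "e = 0")
  case True
  have "i \<in> Poly_Mapping.keys \<alpha> \<union> (\<lambda>i. i - 1) ` Poly_Mapping.keys \<alpha>"
    if "Poly_Mapping.lookup \<alpha> i \<noteq> Poly_Mapping.lookup \<alpha> (i + 1)" for i
  proof (cases "i \<in> Poly_Mapping.keys \<alpha>")
    case False
    then have "i + 1 \<in> Poly_Mapping.keys \<alpha>"
      using that by (simp add: in_keys_iff)
    then have "(i + 1) - 1 \<in> (\<lambda>i. i - 1) ` Poly_Mapping.keys \<alpha>"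
      by (rule imageI)
    then show ?thesis by simp
  qed blast
  then have "{i \<in> residues_mod e. Poly_Mapping.lookup \<alpha> i \<noteq> Poly_Mapping.lookup \<alpha> ((i + 1) mod int e)}
      \<subseteq> Poly_Mapping.keys \<alpha> \<union> (\<lambda>i. i - 1) ` Poly_Mapping.keys \<alpha>"
    using True by auto
  then show ?thesis
    by (rule finite_subset) simp
next
  case False
  then have "finite (residues_mod e)"
    by (simp add: carrier_integer_mod_group)
  then show ?thesis
    by simp
qed

lemma even_diff_square_sum:
  assumes "\<alpha> \<in> root_lattice e"
  shows "even (diff_square_sum e \<alpha>)"
proof -
  define c where "c = Poly_Mapping.lookup \<alpha>"
  define \<sigma> where "\<sigma> = (\<lambda>i. (i + 1) mod int e)"
  define \<tau> where "\<tau> = (\<lambda>i. (i - 1) mod int e)"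
  define D where "D = {i \<in> residues_mod e. c i \<noteq> c (\<sigma> i)}"
  define T where "T = D \<union> Poly_Mapping.keys \<alpha> \<union> \<tau> ` Poly_Mapping.keys \<alpha>"
  define K where "K = Poly_Mapping.keys \<alpha>"
  have K: "K \<subseteq> residues_mod e" "finite K"
    using assms by (auto simp: K_def)
  have fD: "finite D"
    using finite_diff_support[OF assms] by (simp add: D_def c_def \<sigma>_def)
  have fT: "finite T"
    using fD by (simp add: T_def)
  have T: "T \<subseteq> residues_mod e"
    using K mod_in_residues_mod by (auto simp: T_def D_def K_def \<tau>_def)
  have res: "i mod int e = i" if "i \<in> residues_mod e" for i
    using that by (auto simp: carrier_integer_mod_group split: if_splits)
  have \<sigma>\<tau>: "\<sigma> (\<tau> i) = i" "\<tau> (\<sigma> i) = i" if "i \<in> residues_mod e" for i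
    using res[OF that] by (simp_all add: \<sigma>_def \<tau>_def mod_simps)
  have inj: "inj_on \<sigma> T"
    using \<sigma>\<tau>(2) T by (metis inj_on_def subsetD)
  have "(\<Sum>i\<in>T. c i) = (\<Sum>i\<in>K. c i)"
    using fT by (intro sum.mono_neutral_right) (auto simp: T_def K_def c_def in_keys_iff)
  moreover have "(\<Sum>i\<in>T. c (\<sigma> i)) = (\<Sum>i\<in>\<sigma> ` T. c i)"
    using inj by (simp add: sum.reindex)
  moreover have "(\<Sum>i\<in>\<sigma> ` T. c i) = (\<Sum>i\<in>K. c i)"
  proof (intro sum.mono_neutral_right)
    show "K \<subseteq> \<sigma> ` T"
    proof
      fix i assume "i \<in> K"
      then have "i = \<sigma> (\<tau> i)" "\<tau> i \<in> T"
        using \<sigma>\<tau>(1) K by (auto simp: T_def K_def)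
      then show "i \<in> \<sigma> ` T" by blast
    qed
  qed (use fT in \<open>auto simp: K_def c_def in_keys_iff\<close>)
  ultimately have zero: "(\<Sum>i\<in>T. c i - c (\<sigma> i)) = 0"
    by (simp add: sum_subtractf)
  have "diff_square_sum e \<alpha> = (\<Sum>i\<in>D. (c i - c (\<sigma> i))\<^sup>2)"
    by (simp add: diff_square_sum_def Let_def D_def c_def \<sigma>_def)
  also have "\<dots> = (\<Sum>i\<in>T. (c i - c (\<sigma> i))\<^sup>2)"
    using fT T by (intro sum.mono_neutral_left) (auto simp: T_def D_def)
  also have "\<dots> = (\<Sum>i\<in>T. (c i - c (\<sigma> i))\<^sup>2 - (c i - c (\<sigma> i)))"
    using zero by (simp only: sum_subtractf)
  finally have "diff_square_sum e \<alpha> = (\<Sum>i\<in>T. (c i - c (\<sigma> i))\<^sup>2 - (c i - c (\<sigma> i)))" .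
  moreover have "even ((c i - c (\<sigma> i))\<^sup>2 - (c i - c (\<sigma> i)))" for i
    by simp
  ultimately show ?thesis
    by (simp add: dvd_sum)
qed

end

theory Submission
  imports Defs "HOL-Library.Groups_Big_Fun"
begin

text \<open>
  A partition is recorded by its content profile: the function f whose value at an integer x is the
  number of nodes of content x. The profiles are exactly the finitely supported functions whose
  differences f(x) - f(x+1) lie in {0, 1} for x \<ge> 0 and in {-1, 0} for x < 0
  (\<open>is_profile_content_count\<close>, \<open>is_profile_imp_content_count\<close>). These differences are the occupation
  numbers of the abacus (1 for a bead, 0 for a gap), minus those of the empty partition.

  \<^bold>\<open>One component.\<close> Suppose r = 1. If e = 0, summation by parts turns twice the weight
  into the sum over x of t - t^2, where t is the difference at x with the sign that
  is expected there. Every term is at most 0, and all of them vanish exactly when every t is 0 or 1,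
  that is, when the coefficients form a profile. If e > 0, the coefficients of the root of a
  partition are the sums of its profile over residue classes. Put D(i) = c(s+i) - c(s+i+1), the
  charge of runner i. Summation by parts writes c(s) as the sum of the positions of the beads on
  their runners, minus the same sum for the empty partition. A runner of
  charge D contributes at least D(D-1)/2, with equality when its beads are pushed down as far as
  possible (\<open>runner_bound\<close>). As the charges add up to 0, this says that the weight is at least 0.
  Conversely, filling the runners compactly with the prescribed charges and then moving one bead up
  by as many places as the weight says realises every element of nonnegative weight.

  \<^bold>\<open>Several components.\<close> The set of roots of multipartitions is the sumset of the sets for
  the single components. The weight of a sum of A(1), ..., A(r) is r times the sum of the weights of
  the A(j), plus a quarter of the sum of the interactions of all ordered pairs, which depend only on
  the differences A(j) - A(k) (\<open>weight_sum\<close>). Interactions are nonnegative (\<open>interaction_nonneg\<close>),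
  so the weight is nonnegative on roots of multipartitions, for every r and every e > 0. In the other
  direction it suffices to split
  \<alpha> into summands with such small interactions that nonnegativity of the weight of \<alpha> forces the
  weights of the summands to have a nonnegative sum; multiples of the null root \<delta>, the sum of all
  \<alpha>_i, then shift weight between the summands without changing the interactions
  (\<open>root_set_if_small_interaction\<close>). Such balanced splittings exist for (r, e) = (2, 2), (2, 3)
  by halving \<alpha>, and for (3, 2) by dividing its only relevant difference into three nearly equal parts.
\<close>

section \<open>Young diagrams and content profiles\<close>

definition diagram_shape :: "(nat \<times> nat) set \<Rightarrow> bool" where
  "diagram_shape Y \<longleftrightarrow> finite Y \<and> (\<forall>(a, b)\<in>Y. 1 \<le> a \<and> 1 \<le> b)
     \<and> (\<forall>a b. 1 \<le> a \<longrightarrow> (Suc a, b) \<in> Y \<longrightarrow> (a, b) \<in> Y)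
     \<and> (\<forall>a b. 1 \<le> b \<longrightarrow> (a, Suc b) \<in> Y \<longrightarrow> (a, b) \<in> Y)"

lemma diagram_shapeD:
  assumes "diagram_shape Y"
  shows "finite Y"
    and "(a, b) \<in> Y \<Longrightarrow> 1 \<le> a \<and> 1 \<le> b"
    and "(Suc a, b) \<in> Y \<Longrightarrow> 1 \<le> a \<Longrightarrow> (a, b) \<in> Y"
    and "(a, Suc b) \<in> Y \<Longrightarrow> 1 \<le> b \<Longrightarrow> (a, b) \<in> Y"
  using assms unfolding diagram_shape_def by blast+

lemma initial_segment_eq:
  fixes K :: "nat set"
  assumes "finite K" "0 \<notin> K" and step: "\<And>k. 1 \<le> k \<Longrightarrow> Suc k \<in> K \<Longrightarrow> k \<in> K"
  shows "K = {1..card K}"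
proof (cases "K = {}")
  case False
  define M where "M = Max K"
  have "M \<in> K"
    using False assms(1) by (simp add: M_def)
  have "k \<in> K" if "1 \<le> k" "k \<le> M" for k
    using that(2)
  proof (induction rule: inc_induct)
    case base
    show ?case by fact
  next
    case (step n)
    then show ?case using assms(3)[of n] that by simp
  qed
  moreover have "1 \<le> k \<and> k \<le> M" if "k \<in> K" for k
    using that assms(1,2) by (auto simp: M_def Suc_le_eq intro: gr0I)
  ultimately have "K = {1..M}" by (intro Set.set_eqI) (metis atLeastAtMost_iff)
  then show ?thesis by (metis card_atLeastAtMost diff_Suc_1)
qed simp

lemma finite_young_diagram: "finite (young_diagram p)"
proof -
  have "young_diagram p \<subseteq> (SIGMA a:{1..length p}. {1..p ! (a - 1)})"
    by (auto simp: young_diagram_def)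
  then show ?thesis by (rule finite_subset) auto
qed

lemma diagram_shape_young_diagram:
  assumes "is_partition p"
  shows "diagram_shape (young_diagram p)"
proof -
  have "p ! a \<le> p ! (a - 1)" if "1 \<le> a" "a < length p" for a
    using assms that sorted_wrt_nth_less[of "(\<ge>)" p "a - 1" a]
    by (simp add: is_partition_def)
  then have "p ! (Suc a - 1) \<le> p ! (a - 1)" if "1 \<le> a" "Suc a \<le> length p" for a
    using that by simp
  then have "(a, b) \<in> young_diagram p" if "1 \<le> a" "(Suc a, b) \<in> young_diagram p" for a b
    using that by (fastforce simp: young_diagram_def)
  moreover have "(a, b) \<in> young_diagram p" if "1 \<le> b" "(a, Suc b) \<in> young_diagram p" for a b
    using that by (simp add: young_diagram_def)
  moreover have "\<forall>(a, b)\<in>young_diagram p. 1 \<le> a \<and> 1 \<le> b"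
    by (auto simp: young_diagram_def)
  ultimately show ?thesis
    unfolding diagram_shape_def using finite_young_diagram by blast
qed

text \<open>
  The rows and the first column are initial segments of the positive integers, so the row lengths
  determine the set and form a partition.
\<close>

lemma diagram_shape_imp_young_diagram:
  assumes "diagram_shape Y"
  obtains p where "is_partition p" "young_diagram p = Y"
proof -
  note fin = diagram_shapeD(1)[OF assms] and pos = diagram_shapeD(2)[OF assms]
    and down1 = diagram_shapeD(3)[OF assms] and down2 = diagram_shapeD(4)[OF assms]
  define row where "row = (\<lambda>a. {b. (a, b) \<in> Y})"
  define col where "col = {a. (a, 1) \<in> Y}"
  define p where "p = map (\<lambda>a. card (row (Suc a))) [0..<card col]"
  have finr: "finite (row a)" for a
    using finite_subset[of "row a" "snd ` Y"] fin by (force simp: row_def)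
  have finc: "finite col"
    using finite_subset[of "col" "fst ` Y"] fin by (force simp: col_def)
  have row: "row a = {1..card (row a)}" for a
    using down2 pos[of a 0] by (intro initial_segment_eq finr) (auto simp: row_def)
  have col: "col = {1..card col}"
    using down1 pos[of 0 1] by (intro initial_segment_eq finc) (auto simp: col_def)
  have row_ne: "row a \<noteq> {} \<longleftrightarrow> a \<in> col" for a
  proof -
    have "row a \<noteq> {} \<longleftrightarrow> 1 \<in> row a"
      using row[of a] by (metis atLeastAtMost_iff atLeastatMost_empty_iff2 empty_iff order_refl)
    then show ?thesis by (simp add: row_def col_def)
  qed
  have "is_partition p"
    unfolding is_partition_def
  proof
    have "transp ((\<ge>) :: nat \<Rightarrow> nat \<Rightarrow> bool)" by (auto intro: transpI)
    moreover have "card (row (Suc (Suc a))) \<le> card (row (Suc a))" for a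
      using down1 finr by (intro card_mono) (auto simp: row_def)
    ultimately show "sorted_wrt (\<ge>) p"
      by (simp add: sorted_wrt_iff_nth_Suc_transp p_def)
    have "card (row (Suc a)) > 0" if "a < card col" for a
    proof -
      have "Suc a \<in> col" using that by (subst col) simp
      then show ?thesis using row_ne[of "Suc a"] finr by (simp add: card_gt_0_iff)
    qed
    then show "\<forall>x\<in>set p. 0 < x" by (auto simp: p_def)
  qed
  moreover have "young_diagram p = Y"
  proof (intro Set.set_eqI, clarify)
    fix a b
    have "(a, b) \<in> young_diagram p \<longleftrightarrow> a \<in> {1..card col} \<and> b \<in> {1..card (row a)}"
      by (auto simp: young_diagram_def p_def)
    also have "\<dots> \<longleftrightarrow> a \<in> col \<and> b \<in> row a"
      using row[of a] col by simp
    also have "\<dots> \<longleftrightarrow> (a, b) \<in> Y"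
      using row_ne[of a] by (auto simp: row_def)
    finally show "(a, b) \<in> young_diagram p \<longleftrightarrow> (a, b) \<in> Y" .
  qed
  ultimately show ?thesis using that by blast
qed

definition content_count :: "nat list \<Rightarrow> int \<Rightarrow> int" where
  "content_count p x = int (card {(a, b) \<in> young_diagram p. int b - int a = x})"

text \<open>
  The sign of the possible differences f(x) - f(x+1) of a profile: going away from content 0 to the
  right the diagonals get shorter, coming from the left they get longer. Multiplying by this sign
  treats both halves of the diagram at once.
\<close>

definition content_sign :: "int \<Rightarrow> int" where
  "content_sign x = (if x \<ge> 0 then 1 else - 1)"

definition is_profile :: "(int \<Rightarrow> int) \<Rightarrow> bool" where
  "is_profile f \<longleftrightarrow> finite {x. f x \<noteq> 0} \<and> (\<forall>x. content_sign x * (f x - f (x + 1)) \<in> {0, 1})"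

text \<open>
  The k-th cell on the diagonal of content x; at least one of the two \<open>nat\<close> terms vanishes, and k is the
  smaller coordinate.
\<close>

definition diag_cell :: "int \<Rightarrow> nat \<Rightarrow> nat \<times> nat" where
  "diag_cell x k = (k + nat (- x), k + nat x)"

lemma diag_cell_eq_iff: "diag_cell x k = (a, b) \<longleftrightarrow> int b - int a = x \<and> k = min a b"
proof
  assume "diag_cell x k = (a, b)"
  then have "a = k + nat (-x)" "b = k + nat x" by (simp_all add: diag_cell_def)
  then show "int b - int a = x \<and> k = min a b" by linarith
next
  assume "int b - int a = x \<and> k = min a b"
  then have "a = k + nat (- x)" "b = k + nat x" by linarith+
  then show "diag_cell x k = (a, b)" by (simp add: diag_cell_def)
qed

lemma inj_diag_cell: "inj (diag_cell x)"
  by (simp add: inj_def diag_cell_def)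

lemma diagonal_eq:
  "{(a, b) \<in> Y. int b - int a = x} = diag_cell x ` {k. diag_cell x k \<in> Y}"
proof (intro Set.set_eqI, clarify)
  fix a b
  have "(a, b) \<in> diag_cell x ` {k. diag_cell x k \<in> Y}
      \<longleftrightarrow> (\<exists>k. diag_cell x k = (a, b) \<and> (a, b) \<in> Y)"
    by (metis (mono_tags, lifting) image_iff mem_Collect_eq)
  then show "(a, b) \<in> {(a, b) \<in> Y. int b - int a = x}
      \<longleftrightarrow> (a, b) \<in> diag_cell x ` {k. diag_cell x k \<in> Y}"
    by (auto simp: diag_cell_eq_iff)
qed

text \<open>
  Going up and left by one step each stays on the diagonal, so a diagram meets every diagonal in an
  initial segment. Hence the number of nodes of each content determines the diagram.
\<close>

lemma diag_cell_in_young_diagram: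
  assumes "is_partition p"
  shows "diag_cell x k \<in> young_diagram p \<longleftrightarrow> 1 \<le> k \<and> int k \<le> content_count p x"
proof -
  let ?Y = "young_diagram p"
  note shape = diagram_shape_young_diagram[OF assms]
  note pos = diagram_shapeD(2)[OF shape] and up = diagram_shapeD(3)[OF shape]
    and left = diagram_shapeD(4)[OF shape]
  define K where "K = {k. diag_cell x k \<in> ?Y}"
  have "card K = card (diag_cell x ` K)"
    using inj_diag_cell by (intro card_image[symmetric]) (blast intro: inj_on_subset)
  then have card: "content_count p x = int (card K)"
    unfolding content_count_def diagonal_eq K_def by simp
  have "K = {1..card K}"
  proof (rule initial_segment_eq)
    show "finite K"
      using finite_vimageI[OF finite_young_diagram inj_diag_cell] by (simp add: K_def vimage_def)
    show "0 \<notin> K"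
    proof
      assume "0 \<in> K"
      then have "1 \<le> nat (- x) \<and> 1 \<le> nat x"
        using pos by (simp add: K_def diag_cell_def)
      then show False by linarith
    qed
    fix k :: nat assume k: "1 \<le> k" "Suc k \<in> K"
    then have "(Suc (k + nat (- x)), Suc (k + nat x)) \<in> ?Y"
      by (simp add: K_def diag_cell_def)
    then have "(k + nat (- x), k + nat x) \<in> ?Y"
      using k(1) left[of "Suc (k + nat (- x))" "k + nat x"] up[of "k + nat (- x)" "k + nat x"] by simp
    then show "k \<in> K" by (simp add: K_def diag_cell_def)
  qed
  then have "k \<in> K \<longleftrightarrow> 1 \<le> k \<and> k \<le> card K" by (metis atLeastAtMost_iff)
  then show ?thesis by (simp add: card K_def)
qed

text \<open>
  Moving left from a cell of content x + 1, or up from a cell of content x, compares neighbouring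
  diagonals. One of these moves preserves the position k on the diagonal and the other lowers it by 1;
  which one does which depends on the sign of x.
\<close>

lemma is_profile_content_count:
  assumes "is_partition p"
  shows "is_profile (content_count p)"
  unfolding is_profile_def
proof (intro conjI allI)
  let ?Y = "young_diagram p" and ?f = "content_count p"
  note shape = diagram_shape_young_diagram[OF assms]
  note pos = diagram_shapeD(2)[OF shape] and up = diagram_shapeD(3)[OF shape]
    and left = diagram_shapeD(4)[OF shape]
  have "{x. ?f x \<noteq> 0} \<subseteq> (\<lambda>(a, b). int b - int a) ` ?Y"
    by (auto simp: content_count_def dest!: card_gt_0_iff[THEN iffD1])
  then show "finite {x. ?f x \<noteq> 0}"
    using finite_young_diagram finite_subset by blast
  fix x
  have mem: "1 \<le> k \<and> int k \<le> ?f x \<longleftrightarrow> diag_cell x k \<in> ?Y" for x k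
    using diag_cell_in_young_diagram[OF assms] by simp
  have nn: "?f x \<ge> 0" for x by (simp add: content_count_def)
  have ge: "?f x \<le> n" if "\<And>k. diag_cell x k \<in> ?Y \<Longrightarrow> int k \<le> n" "n \<ge> 0" for x n
    using mem[of "nat (?f x)" x] that(1)[of "nat (?f x)"] that(2) nn[of x]
    by (cases "?f x = 0") (simp_all, linarith)
  show "content_sign x * (?f x - ?f (x + 1)) \<in> {0, 1}"
  proof (cases "x \<ge> 0")
    case True
    have s: "nat (x + 1) = Suc (nat x)" "nat (- x) = 0" "nat (- x - 1) = 0" using True by auto
    have "?f (x + 1) \<le> ?f x"
    proof (rule ge)
      fix k assume k: "diag_cell (x + 1) k \<in> ?Y"
      then have "1 \<le> k" using mem by blast
      then have "diag_cell x k \<in> ?Y" using left[of k "k + nat x"] k s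
        by (simp add: diag_cell_def)
      then show "int k \<le> ?f x" using mem by blast
    qed (rule nn)
    moreover have "?f x \<le> ?f (x + 1) + 1"
    proof (rule ge)
      fix k assume k: "diag_cell x k \<in> ?Y"
      show "int k \<le> ?f (x + 1) + 1"
      proof (cases "k \<le> 1")
        case False
        then have "diag_cell (x + 1) (k - 1) \<in> ?Y" using up[of "k - 1" "k + nat x"] k s
          by (simp add: diag_cell_def)
        then have "int (k - 1) \<le> ?f (x + 1)" using mem by blast
        then show ?thesis using False by simp
      qed (use nn[of "x + 1"] in linarith)
    qed (use nn[of "x + 1"] in linarith)
    ultimately show ?thesis using True by (auto simp: content_sign_def)
  next
    case False
    have s: "nat (- x) = Suc (nat (- x - 1))" "nat x = 0" "nat (x + 1) = 0" using False by auto
    have "?f x \<le> ?f (x + 1)"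
    proof (rule ge)
      fix k assume k: "diag_cell x k \<in> ?Y"
      then have "1 \<le> k" using mem by blast
      then have "diag_cell (x + 1) k \<in> ?Y" using up[of "k + nat (- x - 1)" k] k s
        by (simp add: diag_cell_def)
      then show "int k \<le> ?f (x + 1)" using mem by blast
    qed (rule nn)
    moreover have "?f (x + 1) \<le> ?f x + 1"
    proof (rule ge)
      fix k assume k: "diag_cell (x + 1) k \<in> ?Y"
      show "int k \<le> ?f x + 1"
      proof (cases "k \<le> 1")
        case False
        then have "diag_cell x (k - 1) \<in> ?Y" using left[of "k + nat (- x - 1)" "k - 1"] k s
          by (simp add: diag_cell_def)
        then have "int (k - 1) \<le> ?f x" using mem by blast
        then show ?thesis using False by simp
      qed (use nn[of x] in linarith)
    qed (use nn[of x] in linarith)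
    ultimately show ?thesis using False by (auto simp: content_sign_def)
  qed
qed

text \<open>
  Away from content 0 a profile is monotone towards 0, its value far out.
\<close>

lemma is_profile_nonneg:
  assumes "is_profile f"
  shows "f x \<ge> 0"
proof -
  have st: "content_sign y * (f y - f (y + 1)) \<in> {0, 1}" for y
    using assms by (simp add: is_profile_def)
  obtain N where N: "\<And>y. \<bar>y\<bar> > N \<Longrightarrow> f y = 0"
  proof -
    have "finite (abs ` {x. f x \<noteq> 0})" using assms by (simp add: is_profile_def)
    then show ?thesis using that[of "Max (abs ` {x. f x \<noteq> 0})"]
      by (metis (mono_tags, lifting) Max_ge image_eqI mem_Collect_eq not_less)
  qed
  show ?thesis
  proof (cases "x \<ge> 0")
    case True
    have "f x \<ge> f (x + int n)" for n
    proof (induction n)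
      case (Suc n)
      have "f (x + int n) \<ge> f (x + int n + 1)"
        using st[of "x + int n"] True by (auto simp: content_sign_def split: if_splits)
      then show ?case using Suc by (simp add: algebra_simps)
    qed simp
    from this[of "nat (N + 1)"] N[of "x + int (nat (N + 1))"] show ?thesis using True by simp
  next
    case False
    have "f x \<ge> f (x - int n)" for n
    proof (induction n)
      case (Suc n)
      have "f (x - int n - 1) \<le> f (x - int n - 1 + 1)"
        using st[of "x - int n - 1"] False by (auto simp: content_sign_def split: if_splits)
      then show ?case using Suc by (simp add: algebra_simps)
    qed simp
    from this[of "nat (N + 1)"] N[of "x - int (nat (N + 1))"] show ?thesis using False by simp
  qed
qed

text \<open>
  The diagram consists of the first f(x) cells of each diagonal; the condition on the differences of
  f says that it is closed under moving up and left.
\<close>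

lemma is_profile_imp_content_count:
  assumes "is_profile f"
  obtains p where "is_partition p" "content_count p = f"
proof -
  define Y where "Y = {(a, b). 1 \<le> min a b \<and> int (min a b) \<le> f (int b - int a)}"
  have st: "content_sign y * (f y - f (y + 1)) \<in> {0, 1}" for y
    using assms by (simp add: is_profile_def)
  have fin: "finite {x. f x \<noteq> 0}" using assms by (simp add: is_profile_def)
  have diag: "diag_cell x k \<in> Y \<longleftrightarrow> 1 \<le> k \<and> int k \<le> f x" for x k
  proof -
    have "min (k + nat (- x)) (k + nat x) = k" "int (k + nat x) - int (k + nat (- x)) = x" by auto
    then show ?thesis by (auto simp: Y_def diag_cell_def simp del: of_nat_add)
  qed
  have "diagram_shape Y"
    unfolding diagram_shape_def
  proof (intro conjI allI impI)
    have "Y \<subseteq> (\<Union>x\<in>{x. f x \<noteq> 0}. diag_cell x ` {1..nat (f x)})"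
    proof
      fix y assume y: "y \<in> Y"
      obtain a b where ab: "y = (a, b)" by (cases y)
      define x where "x = int b - int a"
      have "y = diag_cell x (min a b)" using diag_cell_eq_iff ab x_def by metis
      moreover from this have "1 \<le> min a b" "int (min a b) \<le> f x" using y diag by blast+
      then have "min a b \<in> {1..nat (f x)}" "f x \<noteq> 0" by (simp add: le_nat_iff, linarith)
      ultimately show "y \<in> (\<Union>x\<in>{x. f x \<noteq> 0}. diag_cell x ` {1..nat (f x)})" by blast
    qed
    then show "finite Y" using fin by (auto intro: finite_subset)
    show "\<forall>(a, b)\<in>Y. 1 \<le> a \<and> 1 \<le> b" by (auto simp: Y_def)
  next
    fix a b :: nat assume "1 \<le> a" "(Suc a, b) \<in> Y"
    moreover have "int b - int (Suc a) + 1 = int b - int a" by simp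
    ultimately show "(a, b) \<in> Y"
      using st[of "int b - int (Suc a)"]
      by (auto simp: Y_def content_sign_def min_def split: if_splits)
  next
    fix a b :: nat assume "1 \<le> b" "(a, Suc b) \<in> Y"
    moreover have "1 + int b - int a = int b - int a + 1" by simp
    ultimately show "(a, b) \<in> Y"
      using st[of "int b - int a"]
      by (auto simp: Y_def content_sign_def min_def split: if_splits)
  qed
  then obtain p where p: "is_partition p" "young_diagram p = Y"
    by (rule diagram_shape_imp_young_diagram)
  have "content_count p x = f x" for x
  proof -
    have "int k \<le> content_count p x \<longleftrightarrow> int k \<le> f x" if "1 \<le> k" for k
      using diag_cell_in_young_diagram[OF p(1), of x k] diag[of x k] p(2) that by simp
    from this[of "nat (f x)"] this[of "nat (content_count p x)"]
    show ?thesis using is_profile_nonneg[OF assms, of x]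
      by (cases "f x = 0"; cases "content_count p x = 0") (auto simp: content_count_def Suc_le_eq)
  qed
  then show ?thesis using p that by blast
qed

section \<open>Summation by parts over the integers\<close>

lemma finite_support_shift:
  assumes "finite {x :: int. f x \<noteq> (0 :: int)}"
  shows "finite {x. f (x + t) \<noteq> 0}"
proof -
  have "{x. f (x + t) \<noteq> 0} = (\<lambda>x. x - t) ` {x. f x \<noteq> 0}"
    by (force simp: image_iff)
  then show ?thesis using assms by simp
qed

lemma finite_support_difference:
  assumes "finite {x :: int. f x \<noteq> (0 :: int)}"
  shows "finite {x. f x - f (x + 1) \<noteq> 0}"
  by (rule finite_subset[OF _ finite_UnI[OF assms finite_support_shift[OF assms, of 1]]]) auto

lemma finite_support_mult:
  assumes "finite {x. f x \<noteq> (0 :: int)}"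
  shows "finite {x. g x * f x \<noteq> 0}"
  by (rule finite_subset[OF _ assms]) auto

lemma Sum_any_diff:
  fixes f g :: "int \<Rightarrow> int"
  assumes "finite {x. f x \<noteq> 0}" "finite {x. g x \<noteq> 0}"
  shows "(\<Sum>x. f x - g x) = (\<Sum>x. f x) - (\<Sum>x. g x)"
proof -
  have "(\<Sum>x. f x) = (\<Sum>x. (f x - g x) + g x)" by simp
  also have "\<dots> = (\<Sum>x. f x - g x) + (\<Sum>x. g x)"
    by (rule Sum_any.distrib[OF finite_subset[OF _ finite_UnI[OF assms]] assms(2)]) auto
  finally show ?thesis by simp
qed

lemma Sum_any_shift: "(\<Sum>x :: int. f (x + t)) = (\<Sum>x. f x :: int)"
proof -
  have "bij (\<lambda>x :: int. x + t)" by (rule bij_plus_right)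
  then have "(\<Sum>x. f x) = (\<Sum>x. f (x + t))"
    by (rule Sum_any.reindex_cong) (simp add: comp_def)
  then show ?thesis by simp
qed

lemma Sum_any_mono:
  fixes f g :: "int \<Rightarrow> int"
  assumes "finite {x. f x \<noteq> 0}" "finite {x. g x \<noteq> 0}" "\<And>x. f x \<le> g x"
  shows "(\<Sum>x. f x) \<le> (\<Sum>x. g x)"
proof -
  let ?A = "{x. f x \<noteq> 0} \<union> {x. g x \<noteq> 0}"
  have "(\<Sum>x. f x) = sum f ?A" "(\<Sum>x. g x) = sum g ?A"
    using assms(1,2) by (auto intro!: Sum_any.expand_superset)
  then show ?thesis using sum_mono[of ?A f g] assms(3) by simp
qed

lemma Sum_any_sum_commute:
  assumes "finite I" "\<And>i. i \<in> I \<Longrightarrow> finite {x. F i x \<noteq> (0 :: int)}"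
  shows "(\<Sum>x. \<Sum>i\<in>I. F i x) = (\<Sum>i\<in>I. \<Sum>x. F i x)"
proof -
  let ?A = "\<Union>i\<in>I. {x. F i x \<noteq> 0}"
  have fin: "finite ?A" using assms by simp
  have "(\<Sum>x. F i x) = sum (F i) ?A" if "i \<in> I" for i
    using that fin by (intro Sum_any.expand_superset) auto
  moreover have "(\<Sum>x. \<Sum>i\<in>I. F i x) = (\<Sum>x\<in>?A. \<Sum>i\<in>I. F i x)"
  proof (rule Sum_any.expand_superset[OF fin], rule subsetI)
    fix x assume "x \<in> {x. (\<Sum>i\<in>I. F i x) \<noteq> 0}"
    then show "x \<in> ?A" by (auto elim: sum.not_neutral_contains_not_neutral)
  qed
  ultimately show ?thesis by (simp add: sum.swap[of _ ?A])
qed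

lemma summation_by_parts:
  fixes f \<phi> :: "int \<Rightarrow> int"
  assumes "finite {x. f x \<noteq> 0}"
  shows "(\<Sum>x. \<phi> x * (f x - f (x + 1))) = (\<Sum>x. (\<phi> x - \<phi> (x - 1)) * f x)"
proof -
  note fin = finite_support_mult[OF assms] finite_support_mult[OF finite_support_shift[OF assms, of 1]]
  have "(\<Sum>x. \<phi> x * (f x - f (x + 1))) = (\<Sum>x. \<phi> x * f x) - (\<Sum>x. \<phi> x * f (x + 1))"
    using fin by (subst Sum_any_diff[symmetric]) (simp_all add: right_diff_distrib)
  also have "(\<Sum>x. \<phi> x * f (x + 1)) = (\<Sum>x. \<phi> (x - 1) * f x)"
    using Sum_any_shift[of "\<lambda>x. \<phi> (x - 1) * f x" 1] by simp
  also have "(\<Sum>x. \<phi> x * f x) - \<dots> = (\<Sum>x. (\<phi> x - \<phi> (x - 1)) * f x)"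
    using fin by (subst Sum_any_diff[symmetric]) (simp_all add: left_diff_distrib)
  finally show ?thesis .
qed

text \<open>
  The sign function jumps only at 0, by 2, so summation by parts leaves twice the value there.
\<close>

lemma sum_signed_differences:
  fixes f :: "int \<Rightarrow> int"
  assumes "finite {x. f x \<noteq> 0}"
  shows "(\<Sum>x. content_sign x * (f x - f (x + 1))) = 2 * f 0"
proof -
  have "(content_sign x - content_sign (x - 1)) * f x = (if x = 0 then 2 * f x else 0)" for x
    by (auto simp: content_sign_def)
  then show ?thesis
    using summation_by_parts[OF assms, of content_sign] Sum_any.delta[of 0 "\<lambda>x. 2 * f x"] by simp
qed

lemma sum_weighted_differences:
  fixes f :: "int \<Rightarrow> int"
  assumes "finite {x. f x \<noteq> 0}"
  shows "(\<Sum>x. x * (f x - f (x + 1))) = (\<Sum>x. f x)"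
  using summation_by_parts[OF assms, of "\<lambda>x. x"] by simp

section \<open>One component, infinite residue set\<close>

lemma lookup_zero_outside:
  assumes "\<alpha> \<in> root_lattice e" "i \<notin> residues_mod e"
  shows "Poly_Mapping.lookup \<alpha> i = 0"
  using assms by (auto simp: in_keys_iff)

lemma lookup_root_of_single:
  "Poly_Mapping.lookup (root_of e [s] [p]) i =
     int (card {(a, b) \<in> young_diagram p. (int b - int a + s) mod int e = i})"
proof -
  have "{n \<in> nodes [p]. node_residue e [s] n = i} =
      (\<lambda>(a, b). (a, b, 1)) ` {(a, b) \<in> young_diagram p. (int b - int a + s) mod int e = i}"
    by (auto simp: nodes_def node_residue_def)
  moreover have "inj_on (\<lambda>(a, b). (a, b, 1 :: nat)) A" for A :: "(nat \<times> nat) set"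
    by (auto simp: inj_on_def)
  ultimately show ?thesis
    by (simp add: lookup_root_of residue_count_def card_image)
qed

lemma root_set_single: "root_set e [s] = (\<lambda>p. root_of e [s] [p]) ` Collect is_partition"
proof -
  have "multipartitions (length [s]) = (\<lambda>p. [p]) ` Collect is_partition"
    by (auto simp: multipartitions_def length_Suc_conv)
  then show ?thesis by (simp add: root_set_def image_image)
qed

lemma weight_single:
  "weight e [s] \<alpha> = Poly_Mapping.lookup \<alpha> (s mod int e) - diff_square_sum e \<alpha> div 2"
  by (simp add: weight_def)

text \<open>
  The linear term c(s) of the weight is a signed sum of differences, which puts it into the same sum as
  the quadratic term.
\<close>

lemma double_weight_single_e0:
  fixes \<alpha> :: "int \<Rightarrow>\<^sub>0 int" and s :: int
  assumes "\<alpha> \<in> root_lattice 0"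
  defines "f \<equiv> \<lambda>x. Poly_Mapping.lookup \<alpha> (x + s)"
  shows "finite {x. f x \<noteq> 0}"
    and "2 * weight 0 [s] \<alpha> =
      (\<Sum>x. content_sign x * (f x - f (x + 1)) - (content_sign x * (f x - f (x + 1)))\<^sup>2)"
proof -
  show fin: "finite {x. f x \<noteq> 0}"
    using finite_support_shift[of "Poly_Mapping.lookup \<alpha>" s] by (simp add: f_def)
  let ?d = "\<lambda>x. f x - f (x + 1)"
  have sq: "(content_sign x * y)\<^sup>2 = y\<^sup>2" for x y by (simp add: content_sign_def)
  have fin2: "finite {x. (?d x)\<^sup>2 \<noteq> 0}" "finite {x. content_sign x * ?d x \<noteq> 0}"
    using finite_support_difference[OF fin] finite_support_mult[OF finite_support_difference[OF fin]]
    by simp_all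
  have "diff_square_sum 0 \<alpha> = (\<Sum>x. (Poly_Mapping.lookup \<alpha> x - Poly_Mapping.lookup \<alpha> (x + 1))\<^sup>2)"
    by (simp add: diff_square_sum_def Let_def Sum_any.expand_set carrier_integer_mod_group)
  also have "\<dots> = (\<Sum>x. (?d x)\<^sup>2)"
    using Sum_any_shift[of "\<lambda>x. (Poly_Mapping.lookup \<alpha> x - Poly_Mapping.lookup \<alpha> (x + 1))\<^sup>2" s]
    by (simp add: f_def algebra_simps)
  finally have "2 * weight 0 [s] \<alpha> = 2 * f 0 - (\<Sum>x. (?d x)\<^sup>2)"
    using even_diff_square_sum[OF assms(1)] by (simp add: weight_single f_def right_diff_distrib)
  also have "\<dots> = (\<Sum>x. content_sign x * ?d x - (?d x)\<^sup>2)"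
    using fin2 by (simp add: sum_signed_differences[OF fin] Sum_any_diff)
  finally show "2 * weight 0 [s] \<alpha> =
      (\<Sum>x. content_sign x * ?d x - (content_sign x * ?d x)\<^sup>2)"
    by (simp add: sq)
qed

lemma int_le_square: "(n :: int) \<le> n\<^sup>2"
  by (cases "n \<le> 0") (use zero_le_power2[of n] in \<open>auto simp: power2_eq_square intro: order_trans\<close>)

lemma int_eq_square_iff: "(n :: int) = n\<^sup>2 \<longleftrightarrow> n \<in> {0, 1}"
  by (auto simp: power2_eq_square)

text \<open>
  For an integer t one has t - t^2 \<le> 0, with equality only for t = 0 and t = 1. So the weight is
  never positive, and it vanishes exactly on profiles.
\<close>

lemma weight_nonneg_e0_iff:
  assumes "\<alpha> \<in> root_lattice 0"
  shows "weight 0 [s] \<alpha> \<ge> 0 \<longleftrightarrow> is_profile (\<lambda>x. Poly_Mapping.lookup \<alpha> (x + s))"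
proof -
  define f where "f = (\<lambda>x. Poly_Mapping.lookup \<alpha> (x + s))"
  define t where "t = (\<lambda>x. content_sign x * (f x - f (x + 1)))"
  have fin: "finite {x. f x \<noteq> 0}" and w: "2 * weight 0 [s] \<alpha> = (\<Sum>x. t x - (t x)\<^sup>2)"
    using double_weight_single_e0[OF assms, of s] by (simp_all add: f_def t_def)
  have "finite {x. t x \<noteq> 0}"
    unfolding t_def by (rule finite_support_mult[OF finite_support_difference[OF fin]])
  then have fint: "finite {x. t x - (t x)\<^sup>2 \<noteq> 0}"
    by (rule rev_finite_subset) auto
  then have w': "2 * weight 0 [s] \<alpha> = - (\<Sum>x | t x - (t x)\<^sup>2 \<noteq> 0. (t x)\<^sup>2 - t x)"
    using w by (simp add: Sum_any.expand_set flip: sum_negf)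
  have nonneg: "0 \<le> (t x)\<^sup>2 - t x" for x
    using int_le_square[of "t x"] by simp
  then have "weight 0 [s] \<alpha> \<ge> 0 \<longleftrightarrow> (\<Sum>x | t x - (t x)\<^sup>2 \<noteq> 0. (t x)\<^sup>2 - t x) = 0"
    using w' sum_nonneg[of "{x. t x - (t x)\<^sup>2 \<noteq> 0}" "\<lambda>x. (t x)\<^sup>2 - t x"] by fastforce
  also have "\<dots> \<longleftrightarrow> (\<forall>x. t x = (t x)\<^sup>2)"
    using sum_nonneg_eq_0_iff[OF fint, of "\<lambda>x. (t x)\<^sup>2 - t x"] nonneg by auto
  also have "\<dots> \<longleftrightarrow> is_profile f"
    using fin by (auto simp: is_profile_def int_eq_square_iff t_def)
  finally show ?thesis by (simp add: f_def)
qed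

lemma root_set_single_e0: "root_set 0 [s] = {\<alpha> \<in> root_lattice 0. weight 0 [s] \<alpha> \<ge> 0}"
proof -
  have lookup: "Poly_Mapping.lookup (root_of 0 [s] [p]) (x + s) = content_count p x" for p x
  proof -
    have "{(a, b) \<in> young_diagram p. int b - int a + s = x + s} =
        {(a, b) \<in> young_diagram p. int b - int a = x}" by auto
    then show ?thesis
      by (simp add: lookup_root_of_single content_count_def)
  qed
  show ?thesis
  proof (intro equalityI subsetI)
    fix \<alpha> assume "\<alpha> \<in> root_set 0 [s]"
    then obtain p where p: "is_partition p" "\<alpha> = root_of 0 [s] [p]"
      by (auto simp: root_set_single)
    have "is_profile (\<lambda>x. Poly_Mapping.lookup \<alpha> (x + s))"
      unfolding p(2) lookup by (rule is_profile_content_count[OF p(1)])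
    moreover have "\<alpha> \<in> root_lattice 0"
      unfolding p(2) by (rule root_of_in_root_lattice)
    ultimately show "\<alpha> \<in> {\<alpha> \<in> root_lattice 0. weight 0 [s] \<alpha> \<ge> 0}"
      using weight_nonneg_e0_iff by blast
  next
    fix \<alpha> assume "\<alpha> \<in> {\<alpha> \<in> root_lattice 0. weight 0 [s] \<alpha> \<ge> 0}"
    then have "is_profile (\<lambda>x. Poly_Mapping.lookup \<alpha> (x + s))"
      using weight_nonneg_e0_iff by blast
    then obtain p where p: "is_partition p"
      "content_count p = (\<lambda>x. Poly_Mapping.lookup \<alpha> (x + s))"
      by (rule is_profile_imp_content_count)
    have "\<alpha> = root_of 0 [s] [p]"
    proof (rule poly_mapping_eqI)
      fix i
      show "Poly_Mapping.lookup \<alpha> i = Poly_Mapping.lookup (root_of 0 [s] [p]) i"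
        using lookup[of p "i - s"] p(2) by simp
    qed
    then show "\<alpha> \<in> root_set 0 [s]" using p(1) by (auto simp: root_set_single)
  qed
qed

section \<open>One component, finite residue set\<close>

lemma residues_mod_pos: "e > 0 \<Longrightarrow> residues_mod e = {0..<int e}"
  by (simp add: carrier_integer_mod_group)

lemma diff_square_sum_pos:
  assumes "e > 0"
  shows "diff_square_sum e \<alpha> = (\<Sum>i\<in>residues_mod e.
    (Poly_Mapping.lookup \<alpha> i - Poly_Mapping.lookup \<alpha> ((i + 1) mod int e))\<^sup>2)"
  unfolding diff_square_sum_def Let_def
  by (rule sum.mono_neutral_left) (auto simp: residues_mod_pos[OF assms])

text \<open>
  Shifting the residues by the charge lets all later sums run over \<open>{0..<int e}\<close>, with the
  distinguished coefficient c(s) at index 0.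
\<close>

lemma diff_square_sum_shifted:
  assumes "e > 0"
  shows "diff_square_sum e \<alpha> = (\<Sum>i\<in>{0..<int e}.
    (Poly_Mapping.lookup \<alpha> ((i + s) mod int e) - Poly_Mapping.lookup \<alpha> ((i + 1 + s) mod int e))\<^sup>2)"
  unfolding diff_square_sum_pos[OF assms] residues_mod_pos[OF assms]
proof (rule sum.reindex_bij_witness[where i = "\<lambda>i. (i + s) mod int e" and j = "\<lambda>j. (j - s) mod int e"])
  fix i assume "i \<in> {0..<int e}"
  then show "((i - s) mod int e + s) mod int e = i"
    by (simp add: mod_simps)
  then have "((i - s) mod int e + 1 + s) mod int e = (i + 1) mod int e"
    by (metis add.assoc add.commute mod_add_left_eq)
  then show "(Poly_Mapping.lookup \<alpha> (((i - s) mod int e + s) mod int e)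
      - Poly_Mapping.lookup \<alpha> (((i - s) mod int e + 1 + s) mod int e))\<^sup>2
      = (Poly_Mapping.lookup \<alpha> i - Poly_Mapping.lookup \<alpha> ((i + 1) mod int e))\<^sup>2"
    using \<open>((i - s) mod int e + s) mod int e = i\<close> by simp
qed (use assms in \<open>simp_all add: mod_simps\<close>)

lemma telescope_int:
  fixes f :: "int \<Rightarrow> int"
  shows "(\<Sum>i\<in>{0..<int n}. f (y + i) - f (y + i + 1)) = f y - f (y + int n)"
proof (induction n)
  case (Suc n)
  have "{0..<int (Suc n)} = insert (int n) {0..<int n}" by auto
  then show ?case using Suc by (simp add: algebra_simps)
qed simp

lemma finite_support_residue_class:
  assumes "finite {x. f x \<noteq> (0 :: int)}" "e > 0"
  shows "finite {k. f (k * int e + i) \<noteq> 0}"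
proof -
  have "{k. f (k * int e + i) \<noteq> 0} = (\<lambda>k. k * int e + i) -` {x. f x \<noteq> 0}" by auto
  moreover have "inj (\<lambda>k. k * int e + i)" using assms(2) by (simp add: inj_def)
  ultimately show ?thesis using finite_vimageI[OF assms(1)] by simp
qed

lemma Sum_any_residue_class:
  fixes g :: "int \<Rightarrow> int"
  assumes "finite {x. g x \<noteq> 0}" "e > 0" "i \<in> {0..<int e}"
  shows "(\<Sum>k. g (k * int e + i)) = (\<Sum>x. if x mod int e = i then g x else 0)"
proof -
  have inv: "(k * int e + i) mod int e = i" "(k * int e + i) div int e = k" for k
    using assms(2,3) by simp_all
  have quot: "x div int e * int e + i = x" if "x mod int e = i" for x
    using div_mult_mod_eq[of x "int e"] that by simp
  have "bij_betw (\<lambda>k. k * int e + i) {k. g (k * int e + i) \<noteq> 0}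
      {x. (if x mod int e = i then g x else 0) \<noteq> 0}"
    by (rule bij_betw_byWitness[where f' = "\<lambda>x. x div int e"])
      (use assms(3) in \<open>auto simp: inv quot split: if_splits\<close>)
  from sum.reindex_bij_betw[OF this, of "\<lambda>x. if x mod int e = i then g x else 0"]
  show ?thesis
    unfolding Sum_any.expand_set by (simp only: inv simp_thms if_True)
qed

lemma Sum_any_by_residues:
  fixes g :: "int \<Rightarrow> int"
  assumes "finite {x. g x \<noteq> 0}" "e > 0"
  shows "(\<Sum>x. g x) = (\<Sum>i\<in>{0..<int e}. \<Sum>k. g (k * int e + i))"
proof -
  have "g x = (\<Sum>i\<in>{0..<int e}. if x mod int e = i then g x else 0)" for x
    using assms(2) by simp
  then have "(\<Sum>x. g x) = (\<Sum>x. \<Sum>i\<in>{0..<int e}. if x mod int e = i then g x else 0)"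
    by presburger
  also have "\<dots> = (\<Sum>i\<in>{0..<int e}. \<Sum>x. if x mod int e = i then g x else 0)"
    by (rule Sum_any_sum_commute) (auto intro: finite_subset[OF _ assms(1)])
  also have "\<dots> = (\<Sum>i\<in>{0..<int e}. \<Sum>k. g (k * int e + i))"
    using Sum_any_residue_class[OF assms] by (intro sum.cong) simp_all
  finally show ?thesis .
qed

lemma lookup_root_of_folded:
  assumes "e > 0"
  shows "Poly_Mapping.lookup (root_of e [s] [p]) ((i + s) mod int e) =
    (\<Sum>k. content_count p (k * int e + i))"
proof -
  define S where "S = {(a, b) \<in> young_diagram p. (int b - int a + s) mod int e = (i + s) mod int e}"
  define h where "h = (\<lambda>(a, b). (int b - int a - i) div int e)"
  have finS: "finite S"
    by (rule finite_subset[OF _ finite_young_diagram[of p]]) (auto simp: S_def)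
  have content: "(x + s) mod int e = (i + s) mod int e \<and> (x - i) div int e = k
      \<longleftrightarrow> x = k * int e + i" for x k
  proof
    assume *: "(x + s) mod int e = (i + s) mod int e \<and> (x - i) div int e = k"
    then have "int e dvd (x + s) - (i + s)" by (simp only: mod_eq_dvd_iff)
    then have "int e dvd x - i" by simp
    then have "(x - i) div int e * int e = x - i" by (rule dvd_div_mult_self)
    then have "k * int e = x - i" using * by simp
    then show "x = k * int e + i" by linarith
  next
    assume x: "x = k * int e + i"
    have "(x + s) mod int e = (i + s) mod int e"
      unfolding x add.assoc by (rule mod_mult_self3)
    moreover have "(x - i) div int e = k" using assms by (simp add: x)
    ultimately show "(x + s) mod int e = (i + s) mod int e \<and> (x - i) div int e = k" by simp
  qed
  have fibre: "{y \<in> S. h y = k} = {(a, b) \<in> young_diagram p. int b - int a = k * int e + i}" for k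
    unfolding S_def h_def
  proof (intro Set.set_eqI, clarify)
    fix a b
    show "(a, b) \<in> {y \<in> {(a, b) \<in> young_diagram p. (int b - int a + s) mod int e = (i + s) mod int e}.
          (case y of (a, b) \<Rightarrow> (int b - int a - i) div int e) = k}
        \<longleftrightarrow> (a, b) \<in> {(a, b) \<in> young_diagram p. int b - int a = k * int e + i}"
      unfolding mem_Collect_eq split_conv using content[of "int b - int a" k] by blast
  qed
  have "(\<Sum>k\<in>h ` S. \<Sum>y\<in>{y \<in> S. h y = k}. 1) = (\<Sum>y\<in>S. 1 :: nat)"
    by (rule sum.group[OF finS finite_imageI[OF finS] order_refl])
  then have "card S = (\<Sum>k\<in>h ` S. card {y \<in> S. h y = k})"
    unfolding card_eq_sum by (rule sym)
  then have "int (card S) = (\<Sum>k\<in>h ` S. content_count p (k * int e + i))"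
    unfolding fibre content_count_def by (simp only: of_nat_sum)
  also have "\<dots> = (\<Sum>k. content_count p (k * int e + i))"
  proof (rule Sum_any.expand_superset[symmetric])
    show "{k. content_count p (k * int e + i) \<noteq> 0} \<subseteq> h ` S"
    proof
      fix k assume "k \<in> {k. content_count p (k * int e + i) \<noteq> 0}"
      then have "int (card {y \<in> S. h y = k}) \<noteq> 0"
        unfolding fibre content_count_def mem_Collect_eq .
      then have "{y \<in> S. h y = k} \<noteq> {}" by (metis card.empty of_nat_0)
      then show "k \<in> h ` S" by blast
    qed
  qed (use finS in simp)
  finally show ?thesis
    by (simp add: lookup_root_of_single S_def)
qed

lemma folded_difference:
  fixes f :: "int \<Rightarrow> int"
  assumes "finite {x. f x \<noteq> 0}" "e > 0"
  shows "(\<Sum>k. f (k * int e + i)) - (\<Sum>k. f (k * int e + (i + 1))) =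
    (\<Sum>k. f (k * int e + i) - f (k * int e + i + 1))"
  using Sum_any_diff[OF finite_support_residue_class[OF assms, of i]
      finite_support_residue_class[OF assms, of "i + 1"]]
  by (simp add: add.assoc)

text \<open>
  Differences at distance e along the multiples of e telescope into differences at distance 1. Summation
  by parts in k then weights each difference by the row k of the abacus in which it lies.
\<close>

lemma folded_at_zero:
  fixes f :: "int \<Rightarrow> int"
  assumes "finite {x. f x \<noteq> 0}" "e > 0"
  shows "(\<Sum>k. f (k * int e)) =
    (\<Sum>i\<in>{0..<int e}. \<Sum>k. k * (f (k * int e + i) - f (k * int e + i + 1)))"
proof -
  have "finite {k. f (k * int e) \<noteq> 0}"
    using finite_support_residue_class[OF assms, of 0] by simp
  then have "(\<Sum>k. f (k * int e)) = (\<Sum>k. k * (f (k * int e) - f ((k + 1) * int e)))"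
    by (rule sum_weighted_differences[symmetric])
  also have "\<dots> = (\<Sum>k. \<Sum>i\<in>{0..<int e}. k * (f (k * int e + i) - f (k * int e + i + 1)))"
    using telescope_int[of f _ e] by (simp add: distrib_right flip: sum_distrib_left)
  also have "\<dots> = (\<Sum>i\<in>{0..<int e}. \<Sum>k. k * (f (k * int e + i) - f (k * int e + i + 1)))"
    using finite_support_residue_class[OF finite_support_difference[OF assms(1)] assms(2)]
    by (intro Sum_any_sum_commute finite_support_mult) simp_all
  finally show ?thesis .
qed

text \<open>
  An abacus runner whose beads fill all positions below D, relative to the runner whose beads fill all
  positions below 0. Its charge is D.
\<close>

definition compact_runner :: "int \<Rightarrow> int \<Rightarrow> int" where
  "compact_runner D k = (if k < D then 1 else 0) - (if k < 0 then 1 else 0)"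

lemma finite_support_compact_runner: "finite {k. compact_runner D k \<noteq> 0}"
  by (rule finite_subset[of _ "{min 0 D..max 0 D}"]) (auto simp: compact_runner_def split: if_splits)

lemma finite_support_point: "finite {k. (if k = a then b k else 0 :: int) \<noteq> 0}"
  by (rule finite_subset[of _ "{a}"]) auto

lemma Sum_compact_runner_add_point:
  "(\<Sum>k. compact_runner D k + (if k = a then 1 else 0)) = (\<Sum>k. compact_runner D k) + 1"
  "(\<Sum>k. k * (compact_runner D k + (if k = a then 1 else 0))) = (\<Sum>k. k * compact_runner D k) + a"
proof -
  show "(\<Sum>k. compact_runner D k + (if k = a then 1 else 0)) = (\<Sum>k. compact_runner D k) + 1"
    by (subst Sum_any.distrib[OF finite_support_compact_runner finite_support_point])
      (use Sum_any.delta[of a "\<lambda>_. 1 :: int"] in simp)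
  have "(\<Sum>k. k * (compact_runner D k + (if k = a then 1 else 0)))
      = (\<Sum>k. k * compact_runner D k + (if k = a then k else 0))"
    by (rule Sum_any.cong) (simp add: distrib_left)
  also have "\<dots> = (\<Sum>k. k * compact_runner D k) + a"
    by (subst Sum_any.distrib[OF finite_support_mult[OF finite_support_compact_runner] finite_support_point])
      (use Sum_any.delta[of a "\<lambda>k. k :: int"] in simp)
  finally show "(\<Sum>k. k * (compact_runner D k + (if k = a then 1 else 0))) = (\<Sum>k. k * compact_runner D k) + a" .
qed

text \<open>
  Raising D by 1 adds a bead at position D.
\<close>

lemma Sum_compact_runner: "(\<Sum>k. compact_runner D k) = D" "2 * (\<Sum>k. k * compact_runner D k) = D * (D - 1)"
proof -
  have Suc: "compact_runner (D + 1) = (\<lambda>k. compact_runner D k + (if k = D then 1 else 0))" for D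
    by (auto simp: compact_runner_def fun_eq_iff)
  have s: "(\<Sum>k. compact_runner (D + 1) k) = (\<Sum>k. compact_runner D k) + 1"
    "(\<Sum>k. k * compact_runner (D + 1) k) = (\<Sum>k. k * compact_runner D k) + D" for D
    unfolding Suc by (rule Sum_compact_runner_add_point)+
  have "(\<Sum>k. compact_runner D k) = D \<and> 2 * (\<Sum>k. k * compact_runner D k) = D * (D - 1)"
  proof (induction D rule: int_induct[where k = 0])
    case base
    have "compact_runner 0 = (\<lambda>k. 0)" by (auto simp: compact_runner_def fun_eq_iff)
    then show ?case by simp
  next
    case (step1 i)
    then show ?case using s[of i] by (simp add: algebra_simps)
  next
    case (step2 i)
    then show ?case using s[of "i - 1"] by (simp add: algebra_simps)
  qed
  then show "(\<Sum>k. compact_runner D k) = D" "2 * (\<Sum>k. k * compact_runner D k) = D * (D - 1)" by auto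
qed

text \<open>
  Compared with the compact runner of the same charge, beads are only moved from positions below D to
  positions at or above D. As the total charge is unchanged, positions may be measured from D, and then
  every change increases the sum.
\<close>

lemma runner_bound:
  fixes G :: "int \<Rightarrow> int"
  assumes fin: "finite {k. G k \<noteq> 0}" and sign: "\<And>k. content_sign k * G k \<in> {0, 1}"
  defines "D \<equiv> \<Sum>k. G k"
  shows "D * (D - 1) \<le> 2 * (\<Sum>k. k * G k)"
proof -
  have "D * G k + (k - D) * compact_runner D k \<le> k * G k" for k
  proof -
    have "(k - D) * (G k - compact_runner D k) \<ge> 0"
      using sign[of k] by (auto simp: compact_runner_def content_sign_def zero_le_mult_iff split: if_splits)
    then show ?thesis by (simp add: algebra_simps)
  qed
  moreover have f1: "finite {k. D * G k \<noteq> 0}" "finite {k. (k - D) * compact_runner D k \<noteq> 0}"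
    "finite {k. k * compact_runner D k \<noteq> 0}" "finite {k. D * compact_runner D k \<noteq> 0}" "finite {k. k * G k \<noteq> 0}"
    by (intro finite_support_mult fin finite_support_compact_runner)+
  moreover have "finite {k. D * G k + (k - D) * compact_runner D k \<noteq> 0}"
    by (rule finite_subset[OF _ finite_UnI[OF f1(1,2)]]) auto
  ultimately have "(\<Sum>k. D * G k + (k - D) * compact_runner D k) \<le> (\<Sum>k. k * G k)"
    by (intro Sum_any_mono)
  moreover have "(\<Sum>k. D * G k + (k - D) * compact_runner D k) = D * D + ((\<Sum>k. k * compact_runner D k) - D * D)"
  proof -
    have "(\<Sum>k. D * G k + (k - D) * compact_runner D k) = (\<Sum>k. D * G k) + (\<Sum>k. (k - D) * compact_runner D k)"
      using f1 by (intro Sum_any.distrib)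
    also have "(\<Sum>k. D * G k) = D * D"
      using Sum_any_right_distrib[OF fin, of D] by (simp add: D_def)
    also have "(\<Sum>k. (k - D) * compact_runner D k) = (\<Sum>k. k * compact_runner D k) - (\<Sum>k. D * compact_runner D k)"
      using f1 by (simp add: left_diff_distrib Sum_any_diff)
    also have "(\<Sum>k. D * compact_runner D k) = D * D"
      using Sum_any_right_distrib[OF finite_support_compact_runner, of D D] by (simp add: Sum_compact_runner(1))
    finally show ?thesis .
  qed
  ultimately show ?thesis using Sum_compact_runner(2)[of D] by linarith
qed

text \<open>
  The topmost bead of the compact runner of charge D is moved up by m positions.
\<close>

lemma runner_exists:
  assumes "m \<ge> 0"
  obtains G :: "int \<Rightarrow> int" where "finite {k. G k \<noteq> 0}" "\<And>k. content_sign k * G k \<in> {0, 1}"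
    "(\<Sum>k. G k) = D" "2 * (\<Sum>k. k * G k) = D * (D - 1) + 2 * m"
proof
  define G where "G = (\<lambda>k. compact_runner (D - 1) k + (if k = D - 1 + m then 1 else 0))"
  show "finite {k. G k \<noteq> 0}"
    by (rule finite_subset[OF _ finite_UnI[OF finite_support_compact_runner[of "D - 1"]
          finite_support_point[of "D - 1 + m" "\<lambda>_. 1"]]]) (auto simp: G_def)
  show "content_sign k * G k \<in> {0, 1}" for k
    using assms by (auto simp: G_def compact_runner_def content_sign_def)
  show "(\<Sum>k. G k) = D" "2 * (\<Sum>k. k * G k) = D * (D - 1) + 2 * m"
    unfolding G_def Sum_compact_runner_add_point using Sum_compact_runner[of "D - 1"] by (simp_all add: algebra_simps)
qed

text \<open>
  A finitely supported function of total 0 is the difference function of its tail sums.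
\<close>

lemma tail_sums:
  fixes g :: "int \<Rightarrow> int"
  assumes "finite {x. g x \<noteq> 0}" "(\<Sum>x. g x) = 0"
  obtains f :: "int \<Rightarrow> int" where "finite {x. f x \<noteq> 0}" "\<And>x. f x - f (x + 1) = g x"
proof
  define f where "f = (\<lambda>x. \<Sum>y. if x \<le> y then g y else 0)"
  obtain M where M: "\<And>y. M < \<bar>y\<bar> \<Longrightarrow> g y = 0"
  proof -
    have "finite (abs ` {x. g x \<noteq> 0})" using assms by simp
    then show ?thesis using that[of "Max (abs ` {x. g x \<noteq> 0})"]
      by (metis (mono_tags, lifting) Max_ge image_eqI mem_Collect_eq not_less)
  qed
  have "f x = 0" if "x \<notin> {- M..M}" for x
  proof (cases "x > M")
    case True
    then have "(if x \<le> y then g y else 0) = 0" for y using M[of y] by simp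
    then show ?thesis by (simp add: f_def)
  next
    case False
    then have "(if x \<le> y then g y else 0) = g y" for y using M[of y] that by auto
    then show ?thesis using assms(2) by (simp add: f_def)
  qed
  then have "{x. f x \<noteq> 0} \<subseteq> {- M..M}" by blast
  then show "finite {x. f x \<noteq> 0}" by (rule finite_subset) simp
  fix x
  have "f x - f (x + 1) = (\<Sum>y. (if x \<le> y then g y else 0) - (if x + 1 \<le> y then g y else 0))"
    unfolding f_def using assms(1)
    by (intro Sum_any_diff[symmetric]) (auto elim!: rev_finite_subset)
  also have "\<dots> = (\<Sum>y. if y = x then g y else 0)"
    by (rule Sum_any.cong) auto
  finally show "f x - f (x + 1) = g x" by simp
qed

lemma double_weight_single:
  fixes \<alpha> :: "int \<Rightarrow>\<^sub>0 int" and s :: int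
  assumes "e > 0" "\<alpha> \<in> root_lattice e"
  defines "b \<equiv> \<lambda>i. Poly_Mapping.lookup \<alpha> ((i + s) mod int e)"
  shows "2 * weight e [s] \<alpha> = 2 * b 0 - (\<Sum>i\<in>{0..<int e}. (b i - b (i + 1))\<^sup>2)"
  using even_diff_square_sum[OF assms(2)] diff_square_sum_shifted[OF assms(1), of \<alpha> s]
  by (simp add: weight_single b_def right_diff_distrib)

lemma content_sign_residue_class:
  assumes "i \<in> {0..<int e}"
  shows "content_sign (k * int e + i) = content_sign k"
proof -
  have "k * int e + i \<ge> 0 \<longleftrightarrow> k \<ge> 0"
  proof
    assume "k * int e + i \<ge> 0"
    show "k \<ge> 0"
    proof (rule ccontr)
      assume "\<not> k \<ge> 0"
      then have "k * int e \<le> - 1 * int e" by (intro mult_right_mono) auto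
      then show False using assms \<open>k * int e + i \<ge> 0\<close> by simp
    qed
  qed (use assms in simp)
  then show ?thesis by (simp add: content_sign_def)
qed

text \<open>
  The bounds for the single runners add up. The sum over i of D(i)(D(i) - 1) is the sum of squares in
  the weight, because the charges D(i) sum to 0 around the circle.
\<close>

lemma weight_root_of_single_nonneg:
  assumes "e > 0" "is_partition p"
  shows "weight e [s] (root_of e [s] [p]) \<ge> 0"
proof -
  let ?I = "{0..<int e}"
  define f where "f = content_count p"
  define b where "b = (\<lambda>i. Poly_Mapping.lookup (root_of e [s] [p]) ((i + s) mod int e))"
  define G where "G = (\<lambda>i k. f (k * int e + i) - f (k * int e + i + 1))"
  have prof: "is_profile f" unfolding f_def by (rule is_profile_content_count[OF assms(2)])
  then have fin: "finite {x. f x \<noteq> 0}" by (simp add: is_profile_def)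
  have b: "b i = (\<Sum>k. f (k * int e + i))" for i
    by (simp add: b_def f_def lookup_root_of_folded[OF assms(1)])
  have D: "b i - b (i + 1) = (\<Sum>k. G i k)" for i
    unfolding b G_def by (rule folded_difference[OF fin assms(1)])
  have "(b i - b (i + 1)) * (b i - b (i + 1) - 1) \<le> 2 * (\<Sum>k. k * G i k)" if "i \<in> ?I" for i
    unfolding D
  proof (rule runner_bound)
    show "finite {k. G i k \<noteq> 0}"
      unfolding G_def
      using finite_support_residue_class[OF finite_support_difference[OF fin] assms(1)] by simp
    show "content_sign k * G i k \<in> {0, 1}" for k
      using prof content_sign_residue_class[OF that, of k] unfolding is_profile_def G_def by metis
  qed
  then have "(\<Sum>i\<in>?I. (b i - b (i + 1)) * (b i - b (i + 1) - 1)) \<le> (\<Sum>i\<in>?I. 2 * (\<Sum>k. k * G i k))"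
    by (rule sum_mono)
  also have "\<dots> = 2 * b 0"
    using folded_at_zero[OF fin assms(1)] b[of 0] by (simp add: G_def flip: sum_distrib_left)
  also have "(\<Sum>i\<in>?I. (b i - b (i + 1)) * (b i - b (i + 1) - 1)) =
      (\<Sum>i\<in>?I. (b i - b (i + 1))\<^sup>2) - (\<Sum>i\<in>?I. b i - b (i + 1))"
    by (simp add: power2_eq_square algebra_simps flip: sum_subtractf)
  also have "(\<Sum>i\<in>?I. b i - b (i + 1)) = 0"
    using telescope_int[of b 0 e] by (simp add: b_def)
  finally show ?thesis
    using double_weight_single[OF assms(1) root_of_in_root_lattice[of e "[s]" "[p]"], of s]
    by (simp add: b_def)
qed

text \<open>
  The abacus has the runner charges prescribed by the differences of \<alpha>, and the weight of \<alpha> is the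
  number of places by which one bead on runner 0 is moved up. The profile with this abacus has the same
  differences as \<alpha> and the same coefficient at s, hence the same coefficients.
\<close>

lemma weight_nonneg_imp_root_set_single:
  assumes e: "e > 0" and \<alpha>: "\<alpha> \<in> root_lattice e" "weight e [s] \<alpha> \<ge> 0"
  shows "\<alpha> \<in> root_set e [s]"
proof -
  let ?I = "{0..<int e}"
  define b where "b = (\<lambda>i. Poly_Mapping.lookup \<alpha> ((i + s) mod int e))"
  define D where "D = (\<lambda>i. b i - b (i + 1))"
  \<comment> \<open>the excess over the compact runners, all of it put on runner 0\<close>
  define m where "m = (\<lambda>i :: int. if i = 0 then weight e [s] \<alpha> else 0)"
  define runner where "runner = (\<lambda>i G. finite {k :: int. G k \<noteq> 0}
      \<and> (\<forall>k. content_sign k * G k \<in> {0, 1})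
      \<and> (\<Sum>k. G k) = D i \<and> 2 * (\<Sum>k. k * G k) = D i * (D i - 1) + 2 * m i)"
  have "\<exists>G. runner i G" for i
  proof -
    have "m i \<ge> 0" using \<alpha>(2) by (simp add: m_def)
    then show ?thesis unfolding runner_def by (rule runner_exists[of "m i" "D i"]) blast
  qed
  then obtain G where "runner i (G i)" for i by metis
  then have G: "finite {k. G i k \<noteq> 0}" "content_sign k * G i k \<in> {0, 1}"
      "(\<Sum>k. G i k) = D i" "2 * (\<Sum>k. k * G i k) = D i * (D i - 1) + 2 * m i" for i k
    unfolding runner_def by blast+
  define g where "g = (\<lambda>x. G (x mod int e) (x div int e))"
  have g: "g (k * int e + i) = G i k" if "i \<in> ?I" for i k
    using that by (simp add: g_def)
  have "{x. g x \<noteq> 0} \<subseteq> (\<Union>i\<in>?I. (\<lambda>k. k * int e + i) ` {k. G i k \<noteq> 0})"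
  proof
    fix x assume "x \<in> {x. g x \<noteq> 0}"
    then have "x div int e \<in> {k. G (x mod int e) k \<noteq> 0}" by (simp add: g_def)
    moreover have "x = x div int e * int e + x mod int e" by simp
    moreover have "x mod int e \<in> ?I" using e by simp
    ultimately show "x \<in> (\<Union>i\<in>?I. (\<lambda>k. k * int e + i) ` {k. G i k \<noteq> 0})" by blast
  qed
  then have fing: "finite {x. g x \<noteq> 0}"
    by (rule finite_subset) (use G(1) in simp)
  have sumD: "(\<Sum>i\<in>?I. D i) = 0"
    using telescope_int[of b 0 e] by (simp add: D_def b_def)
  have "(\<Sum>x. g x) = (\<Sum>i\<in>?I. D i)"
    unfolding Sum_any_by_residues[OF fing e] by (intro sum.cong) (simp_all add: g G(3))
  then obtain f where f: "finite {x. f x \<noteq> 0}" "\<And>x. f x - f (x + 1) = g x"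
    using tail_sums[OF fing] sumD by metis
  have "content_sign x * g x \<in> {0, 1}" for x
  proof -
    have "x = x div int e * int e + x mod int e" by simp
    then have "content_sign x = content_sign (x div int e)"
      using content_sign_residue_class[of "x mod int e" e "x div int e"] e by simp
    then show ?thesis using G(2) by (simp add: g_def)
  qed
  then have "is_profile f" using f by (simp add: is_profile_def)
  then obtain p where p: "is_partition p" "content_count p = f"
    by (rule is_profile_imp_content_count)
  define b' where "b' = (\<lambda>i. Poly_Mapping.lookup (root_of e [s] [p]) ((i + s) mod int e))"
  have b': "b' i = (\<Sum>k. f (k * int e + i))" for i
    by (simp add: b'_def p(2) lookup_root_of_folded[OF e])
  have diff: "b' i - b' (i + 1) = b i - b (i + 1)" if "i \<in> ?I" for i
    using that folded_difference[OF f(1) e, of i] by (simp add: b' f(2) g G(3) D_def)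
  have "2 * b' 0 = (\<Sum>i\<in>?I. D i * (D i - 1) + 2 * m i)"
  proof -
    have "b' 0 = (\<Sum>i\<in>?I. \<Sum>k. k * G i k)"
      using folded_at_zero[OF f(1) e] b'[of 0] by (simp add: f(2) g)
    then show ?thesis by (simp add: G(4) sum_distrib_left)
  qed
  also have "\<dots> = (\<Sum>i\<in>?I. (D i)\<^sup>2) - (\<Sum>i\<in>?I. D i) + 2 * (\<Sum>i\<in>?I. m i)"
    by (simp add: sum.distrib sum_subtractf sum_distrib_left power2_eq_square algebra_simps)
  also have "(\<Sum>i\<in>?I. m i) = weight e [s] \<alpha>"
    using e by (simp add: m_def)
  also have "(\<Sum>i\<in>?I. (D i)\<^sup>2) - (\<Sum>i\<in>?I. D i) + 2 * weight e [s] \<alpha> = 2 * b 0"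
    using double_weight_single[OF e \<alpha>(1), of s] sumD by (simp add: D_def b_def)
  finally have zero: "b' 0 = b 0" by simp
  have same: "b' (int n) = b (int n)" if "n \<le> e" for n
  proof -
    have "(\<Sum>i\<in>{0..<int n}. b' i - b' (i + 1)) = (\<Sum>i\<in>{0..<int n}. b i - b (i + 1))"
      using that diff by (intro sum.cong) auto
    then show ?thesis using telescope_int[of b' 0 n] telescope_int[of b 0 n] zero by simp
  qed
  have "\<alpha> = root_of e [s] [p]"
  proof (rule poly_mapping_eqI)
    fix j
    show "Poly_Mapping.lookup \<alpha> j = Poly_Mapping.lookup (root_of e [s] [p]) j"
    proof (cases "j \<in> residues_mod e")
      case True
      define n where "n = nat ((j - s) mod int e)"
      have n1: "int n = (j - s) mod int e" using e by (simp add: n_def)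
      have n2: "n \<le> e" using e n1 pos_mod_bound[of "int e" "j - s"] by linarith
      note n = n1 n2
      have "(int n + s) mod int e = j"
        using True e by (simp add: n(1) mod_simps residues_mod_pos)
      then show ?thesis using same[OF n(2)] by (simp add: b_def b'_def)
    next
      case False
      then show ?thesis
        using lookup_zero_outside[OF \<alpha>(1)] lookup_zero_outside[OF root_of_in_root_lattice] by metis
    qed
  qed
  then show ?thesis using p(1) by (auto simp: root_set_single)
qed

lemma root_set_single_weight: "root_set e [s] = {\<alpha> \<in> root_lattice e. weight e [s] \<alpha> \<ge> 0}"
proof (cases "e = 0")
  case True
  then show ?thesis using root_set_single_e0 by simp
next
  case False
  then have "e > 0" by simp
  then show ?thesis
    using weight_root_of_single_nonneg weight_nonneg_imp_root_set_single root_of_in_root_lattice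
    by (auto simp: root_set_single simp del: carrier_free_Abelian_group_iff)
qed

section \<open>Interaction between components\<close>

lemma root_of_eq_sum:
  "root_of e s l = (\<Sum>j<length l. root_of e [s ! j] [l ! j])"
proof (rule poly_mapping_eqI)
  fix i
  define N where "N = (\<lambda>j. {(a, b) \<in> young_diagram (l ! j). (int b - int a + s ! j) mod int e = i})"
  define h where "h = (\<lambda>j (a :: nat, b :: nat). (a, b, Suc j))"
  have nodes: "{n \<in> nodes l. node_residue e s n = i} = (\<Union>j<length l. h j ` N j)"
  proof (intro equalityI subsetI)
    fix n assume n: "n \<in> {n \<in> nodes l. node_residue e s n = i}"
    obtain a b j where abj: "n = (a, b, j)" by (cases n)
    with n have "j - 1 < length l" "j = Suc (j - 1)" "(a, b) \<in> N (j - 1)"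
      by (auto simp: nodes_def node_residue_def N_def)
    then show "n \<in> (\<Union>j<length l. h j ` N j)"
      unfolding abj by (intro UN_I[of "j - 1"] image_eqI[of _ _ "(a, b)"]) (auto simp: h_def)
  qed (auto simp: nodes_def node_residue_def N_def h_def)
  have fin: "finite (N j)" for j
    by (rule finite_subset[OF _ finite_young_diagram[of "l ! j"]]) (auto simp: N_def)
  have "card (\<Union>j<length l. h j ` N j) = (\<Sum>j<length l. card (h j ` N j))"
    by (rule card_UN_disjoint) (use fin in \<open>auto simp: h_def\<close>)
  also have "\<dots> = (\<Sum>j<length l. card (N j))"
    by (intro sum.cong refl card_image) (auto simp: inj_on_def h_def)
  finally have "Poly_Mapping.lookup (root_of e s l) i = (\<Sum>j<length l. int (card (N j)))"
    by (simp add: lookup_root_of residue_count_def nodes)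
  then show "Poly_Mapping.lookup (root_of e s l) i =
      Poly_Mapping.lookup (\<Sum>j<length l. root_of e [s ! j] [l ! j]) i"
    by (simp add: lookup_sum lookup_root_of_single N_def)
qed

text \<open>
  The nodes of a multipartition are the disjoint union of the nodes of its components, and the
  components can be chosen independently.
\<close>

lemma root_set_iff_decomposition:
  "\<alpha> \<in> root_set e s \<longleftrightarrow>
    (\<exists>A. \<alpha> = (\<Sum>j<length s. A j) \<and> (\<forall>j<length s. A j \<in> root_lattice e \<and> weight e [s ! j] (A j) \<ge> 0))"
proof -
  have "\<alpha> \<in> root_set e s \<longleftrightarrow>
      (\<exists>A. \<alpha> = (\<Sum>j<length s. A j) \<and> (\<forall>j<length s. A j \<in> root_set e [s ! j]))"
  proof
    assume "\<alpha> \<in> root_set e s"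
    then obtain l where l: "l \<in> multipartitions (length s)" "\<alpha> = root_of e s l"
      by (auto simp: root_set_def)
    then have "\<alpha> = (\<Sum>j<length s. root_of e [s ! j] [l ! j])"
      using root_of_eq_sum[of e s l] by (simp add: multipartitions_def)
    moreover have "root_of e [s ! j] [l ! j] \<in> root_set e [s ! j]" if "j < length s" for j
      using l(1) that by (auto simp: root_set_single multipartitions_def)
    ultimately show "\<exists>A. \<alpha> = (\<Sum>j<length s. A j) \<and> (\<forall>j<length s. A j \<in> root_set e [s ! j])"
      by (intro exI[of _ "\<lambda>j. root_of e [s ! j] [l ! j]"]) simp
  next
    assume "\<exists>A. \<alpha> = (\<Sum>j<length s. A j) \<and> (\<forall>j<length s. A j \<in> root_set e [s ! j])"
    then obtain A where A: "\<alpha> = (\<Sum>j<length s. A j)"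
      and mem: "\<forall>j<length s. A j \<in> root_set e [s ! j]"
      by (elim exE conjE)
    have ex: "\<exists>p. is_partition p \<and> A j = root_of e [s ! j] [p]" if "j < length s" for j
      using mem that unfolding root_set_single by fast
    define p where "p = (\<lambda>j. SOME p. is_partition p \<and> A j = root_of e [s ! j] [p])"
    have p: "is_partition (p j) \<and> A j = root_of e [s ! j] [p j]" if "j < length s" for j
      unfolding p_def by (rule someI_ex) (rule ex[OF that])
    define l where "l = map p [0..<length s]"
    have "l \<in> multipartitions (length s)"
      using p by (auto simp: l_def multipartitions_def)
    moreover have "\<alpha> = root_of e s l"
      using root_of_eq_sum[of e s l] A p by (simp add: l_def)
    ultimately show "\<alpha> \<in> root_set e s" by (simp add: root_set_def)
  qed
  then show ?thesis by (simp add: root_set_single_weight)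
qed

lemma double_weight:
  assumes "\<alpha> \<in> root_lattice e"
  shows "2 * weight e s \<alpha> =
    2 * (\<Sum>j<length s. Poly_Mapping.lookup \<alpha> (s ! j mod int e)) - diff_square_sum e \<alpha>"
proof -
  have "(\<Sum>j\<in>{1..length s}. Poly_Mapping.lookup \<alpha> ((s ! (j - 1)) mod int e)) =
      (\<Sum>j<length s. Poly_Mapping.lookup \<alpha> (s ! j mod int e))"
    by (rule sum.reindex_bij_witness[of _ Suc "\<lambda>j. j - 1"]) auto
  then show ?thesis
    using even_diff_square_sum[OF assms] by (simp add: weight_def right_diff_distrib)
qed

text \<open>
  Twice what two components of charges s and t, whose roots differ by \<gamma>, contribute to the weight of
  a sum beyond the weights of the components.
\<close>

definition interaction :: "nat \<Rightarrow> int \<Rightarrow> int \<Rightarrow> (int \<Rightarrow>\<^sub>0 int) \<Rightarrow> int" where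
  "interaction e s t \<gamma> = diff_square_sum e \<gamma> +
     2 * (Poly_Mapping.lookup \<gamma> (t mod int e) - Poly_Mapping.lookup \<gamma> (s mod int e))"

text \<open>
  The residues s and t cut the circle of residues into two arcs, and the sums of the differences of \<gamma>
  over the two arcs are opposite. Giving the arcs opposite signs therefore expresses twice the difference
  of the two coefficients of \<gamma> as a signed sum of all differences, and d and -d are both at most d^2.
\<close>

lemma interaction_nonneg:
  assumes "e > 0"
  shows "interaction e s t \<gamma> \<ge> 0"
proof -
  define b where "b = (\<lambda>i. Poly_Mapping.lookup \<gamma> ((i + s) mod int e))"
  define n where "n = nat ((t - s) mod int e)"
  have n: "int n = (t - s) mod int e" "int n < int e"
    using assms by (simp_all add: n_def)
  define d where "d = (\<lambda>i. b i - b (i + 1))"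
  \<comment> \<open>opposite signs on the arc from s to t and on the arc back\<close>
  define \<sigma> where "\<sigma> = (\<lambda>i. (if i < int n then 1 else - 1) :: int)"
  have "\<sigma> i * d i \<le> (d i)\<^sup>2" for i
    using int_le_square[of "d i"] int_le_square[of "- d i"] by (simp add: \<sigma>_def)
  then have "(\<Sum>i\<in>{0..<int e}. \<sigma> i * d i) \<le> (\<Sum>i\<in>{0..<int e}. (d i)\<^sup>2)"
    by (rule sum_mono)
  also have "\<dots> = diff_square_sum e \<gamma>"
    using diff_square_sum_shifted[OF assms, of \<gamma> s] by (simp add: d_def b_def)
  also have "(\<Sum>i\<in>{0..<int e}. \<sigma> i * d i) =
      2 * (\<Sum>i\<in>{0..<int e}. if i < int n then d i else 0) - (\<Sum>i\<in>{0..<int e}. d i)"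
    unfolding sum_distrib_left sum_subtractf[symmetric] by (intro sum.cong) (auto simp: \<sigma>_def)
  also have "(\<Sum>i\<in>{0..<int e}. if i < int n then d i else 0) = (\<Sum>i\<in>{0..<int n}. d i)"
    by (rule sum.mono_neutral_cong_right) (use n in auto)
  also have "\<dots> = b 0 - b (int n)"
    using telescope_int[of b 0 n] by (simp add: d_def)
  also have "(\<Sum>i\<in>{0..<int e}. d i) = 0"
    using telescope_int[of b 0 e] by (simp add: d_def b_def)
  finally show ?thesis
    by (simp add: interaction_def b_def n(1) mod_simps)
qed

lemma sum_pairwise_square_differences:
  fixes x :: "nat \<Rightarrow> int"
  shows "(\<Sum>j<r. \<Sum>k<r. (x j - x k)\<^sup>2) = 2 * int r * (\<Sum>j<r. (x j)\<^sup>2) - 2 * (\<Sum>j<r. x j)\<^sup>2"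
proof -
  have "(\<Sum>j<r. \<Sum>k<r. (x j - x k)\<^sup>2) =
      (\<Sum>j<r. \<Sum>k<r. (x j)\<^sup>2 + (x k)\<^sup>2 - 2 * (x j * x k))"
    by (simp add: power2_eq_square algebra_simps)
  also have "\<dots> = 2 * int r * (\<Sum>j<r. (x j)\<^sup>2) - 2 * (\<Sum>j<r. \<Sum>k<r. x j * x k)"
    by (simp add: sum.distrib sum_subtractf sum_distrib_left algebra_simps)
  also have "(\<Sum>j<r. \<Sum>k<r. x j * x k) = (\<Sum>j<r. x j)\<^sup>2"
    by (simp add: power2_eq_square sum_product)
  finally show ?thesis .
qed

lemma sum_pairwise_diff_square_sums:
  assumes "e > 0"
  shows "(\<Sum>j<r. \<Sum>k<r. diff_square_sum e (A j - A k)) =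
    2 * int r * (\<Sum>j<r. diff_square_sum e (A j)) - 2 * diff_square_sum e (\<Sum>j<r. A j)"
proof -
  let ?R = "residues_mod e"
  define x where "x = (\<lambda>j i. Poly_Mapping.lookup (A j) i - Poly_Mapping.lookup (A j) ((i + 1) mod int e))"
  have "(\<Sum>j<r. \<Sum>k<r. diff_square_sum e (A j - A k)) = (\<Sum>j<r. \<Sum>k<r. \<Sum>i\<in>?R. (x j i - x k i)\<^sup>2)"
    unfolding diff_square_sum_pos[OF assms] x_def lookup_minus
    by (intro sum.cong refl arg_cong[where f = "\<lambda>t. t\<^sup>2"]) simp
  also have "\<dots> = (\<Sum>i\<in>?R. \<Sum>j<r. \<Sum>k<r. (x j i - x k i)\<^sup>2)"
    by (simp add: sum.swap[of _ "{..<r}" ?R])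
  also have "\<dots> = (\<Sum>i\<in>?R. 2 * int r * (\<Sum>j<r. (x j i)\<^sup>2) - 2 * (\<Sum>j<r. x j i)\<^sup>2)"
    by (simp only: sum_pairwise_square_differences)
  also have "\<dots> = 2 * int r * (\<Sum>j<r. \<Sum>i\<in>?R. (x j i)\<^sup>2) - 2 * (\<Sum>i\<in>?R. (\<Sum>j<r. x j i)\<^sup>2)"
    by (simp add: sum_subtractf sum.swap[of _ "{..<r}" ?R] flip: sum_distrib_left)
  also have "(\<Sum>i\<in>?R. (\<Sum>j<r. x j i)\<^sup>2) = diff_square_sum e (\<Sum>j<r. A j)"
    by (simp add: diff_square_sum_pos[OF assms] x_def lookup_sum sum_subtractf)
  finally show ?thesis
    by (simp add: diff_square_sum_pos[OF assms] x_def)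
qed

lemma sum_in_root_lattice:
  assumes "\<And>j. j < r \<Longrightarrow> A j \<in> root_lattice e"
  shows "(\<Sum>j<(r :: nat). A j) \<in> root_lattice e"
proof -
  have "i \<in> residues_mod e" if "i \<in> Poly_Mapping.keys (\<Sum>j<r. A j)" for i
  proof (rule ccontr)
    assume "i \<notin> residues_mod e"
    then have "Poly_Mapping.lookup (A j) i = 0" if "j < r" for j
      using lookup_zero_outside[OF assms[OF that]] by blast
    then show False using that by (simp add: in_keys_iff lookup_sum)
  qed
  then show ?thesis unfolding carrier_free_Abelian_group_iff by blast
qed

text \<open>
  The quadratic part of the weight is a sum of squares of linear forms, to which
  \<open>sum_pairwise_square_differences\<close> applies; the linear parts of the interactions correct each
  coefficient of A(j) at a foreign charge to the coefficient at its own charge.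
\<close>

lemma weight_sum:
  assumes e: "e > 0" and A: "\<And>j. j < length s \<Longrightarrow> A j \<in> root_lattice e"
  defines "r \<equiv> length s"
  shows "4 * weight e s (\<Sum>j<r. A j) = 4 * int r * (\<Sum>j<r. weight e [s ! j] (A j)) +
    (\<Sum>j<r. \<Sum>k<r. interaction e (s ! j) (s ! k) (A j - A k))"
proof -
  define c where "c = (\<lambda>j k. Poly_Mapping.lookup (A j) (s ! k mod int e))"
  define S where "S = (\<Sum>j<r. \<Sum>k<r. c j k)"
  define T where "T = (\<Sum>j<r. c j j)"
  have "2 * weight e s (\<Sum>j<r. A j) =
      2 * (\<Sum>k<r. \<Sum>j<r. c j k) - diff_square_sum e (\<Sum>j<r. A j)"
    using double_weight[OF sum_in_root_lattice[of r A e], of s] A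
    by (simp add: r_def c_def lookup_sum)
  also have "(\<Sum>k<r. \<Sum>j<r. c j k) = S"
    unfolding S_def by (rule sum.swap)
  finally have W: "2 * weight e s (\<Sum>j<r. A j) = 2 * S - diff_square_sum e (\<Sum>j<r. A j)" .
  have "2 * weight e [s ! j] (A j) = 2 * c j j - diff_square_sum e (A j)" if "j < r" for j
    using double_weight[OF A, of j "[s ! j]"] that by (simp add: r_def c_def)
  then have "(\<Sum>j<r. 2 * weight e [s ! j] (A j)) = (\<Sum>j<r. 2 * c j j - diff_square_sum e (A j))"
    by (intro sum.cong) auto
  then have w: "2 * (\<Sum>j<r. weight e [s ! j] (A j)) = 2 * T - (\<Sum>j<r. diff_square_sum e (A j))"
    by (simp add: T_def sum_subtractf sum_distrib_left)
  have "(\<Sum>j<r. \<Sum>k<r. interaction e (s ! j) (s ! k) (A j - A k)) =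
      (\<Sum>j<r. \<Sum>k<r. diff_square_sum e (A j - A k))
      + (\<Sum>j<r. \<Sum>k<r. 2 * (c j k - c k k - (c j j - c k j)))"
    by (simp add: interaction_def sum.distrib c_def lookup_minus)
  also have "(\<Sum>j<r. \<Sum>k<r. 2 * (c j k - c k k - (c j j - c k j))) =
      2 * (\<Sum>j<r. \<Sum>k<r. c j k) - 2 * (\<Sum>j<r. \<Sum>k<r. c k k) - 2 * (\<Sum>j<r. \<Sum>k<r. c j j)
      + 2 * (\<Sum>j<r. \<Sum>k<r. c k j)"
    by (simp only: sum.distrib sum_subtractf sum_distrib_left right_diff_distrib)
  also have "(\<Sum>j<r. \<Sum>k<r. c k j) = S" unfolding S_def by (rule sum.swap)
  also have "(\<Sum>j<r. \<Sum>k<r. c j j) = int r * T" by (simp add: T_def sum_distrib_left)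
  also have "(\<Sum>j<r. \<Sum>k<r. c k k) = int r * T" by (simp add: T_def)
  finally have I: "(\<Sum>j<r. \<Sum>k<r. interaction e (s ! j) (s ! k) (A j - A k)) =
      2 * int r * (\<Sum>j<r. diff_square_sum e (A j)) - 2 * diff_square_sum e (\<Sum>j<r. A j)
      + 4 * S - 4 * (int r * T)"
    by (simp add: sum_pairwise_diff_square_sums[OF e] S_def)
  have "4 * int r * (\<Sum>j<r. weight e [s ! j] (A j)) =
      2 * int r * (2 * T - (\<Sum>j<r. diff_square_sum e (A j)))"
    unfolding w[symmetric] by simp
  then show ?thesis using W I by (simp add: algebra_simps)
qed

lemma weight_nonneg_of_root_set:
  assumes "e > 0" "\<alpha> \<in> root_set e s"
  shows "weight e s \<alpha> \<ge> 0"
proof -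
  obtain A where A: "\<alpha> = (\<Sum>j<length s. A j)"
    "\<And>j. j < length s \<Longrightarrow> A j \<in> root_lattice e \<and> weight e [s ! j] (A j) \<ge> 0"
    using assms(2) unfolding root_set_iff_decomposition by blast
  have "4 * weight e s \<alpha> \<ge> 0"
    unfolding A(1) using A(2) interaction_nonneg[OF assms(1)]
    by (subst weight_sum[OF assms(1)]) (auto intro!: add_nonneg_nonneg mult_nonneg_nonneg sum_nonneg)
  then show ?thesis by simp
qed

definition from_coeffs :: "nat \<Rightarrow> (int \<Rightarrow> int) \<Rightarrow> (int \<Rightarrow>\<^sub>0 int)" where
  "from_coeffs e v = (\<Sum>i\<in>residues_mod e. frag_cmul (v i) (frag_of i))"

lemma lookup_from_coeffs:
  assumes "e > 0"
  shows "Poly_Mapping.lookup (from_coeffs e v) i = (if i \<in> residues_mod e then v i else 0)"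
proof -
  have "finite (residues_mod e)" using assms by (simp add: residues_mod_pos)
  moreover have "Poly_Mapping.lookup (from_coeffs e v) i =
      (\<Sum>k\<in>residues_mod e. if i = k then v k else 0)"
    unfolding from_coeffs_def lookup_sum by (intro sum.cong) auto
  ultimately show ?thesis by simp
qed

lemma from_coeffs_in_root_lattice:
  assumes "e > 0"
  shows "from_coeffs e v \<in> root_lattice e"
  unfolding carrier_free_Abelian_group_iff
proof
  fix i assume "i \<in> Poly_Mapping.keys (from_coeffs e v)"
  then have "Poly_Mapping.lookup (from_coeffs e v) i \<noteq> 0" by (simp add: in_keys_iff)
  then show "i \<in> residues_mod e" by (simp add: lookup_from_coeffs[OF assms] split: if_splits)
qed

text \<open>
  The differences of neighbouring coefficients do not see the null root, so it changes only the linear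
  part of the weight.
\<close>

lemma weight_single_add_null_root:
  assumes "e > 0" "\<alpha> \<in> root_lattice e"
  shows "\<alpha> + from_coeffs e (\<lambda>_. n) \<in> root_lattice e"
    and "weight e [t] (\<alpha> + from_coeffs e (\<lambda>_. n)) = weight e [t] \<alpha> + n"
proof -
  show "\<alpha> + from_coeffs e (\<lambda>_. n) \<in> root_lattice e"
    using assms(2) from_coeffs_in_root_lattice[OF assms(1)] keys_add[of \<alpha> "from_coeffs e (\<lambda>_. n)"]
    unfolding carrier_free_Abelian_group_iff by blast
  have "diff_square_sum e (\<alpha> + from_coeffs e (\<lambda>_. n)) = diff_square_sum e \<alpha>"
    unfolding diff_square_sum_pos[OF assms(1)]
    by (intro sum.cong) (simp_all add: lookup_add lookup_from_coeffs[OF assms(1)] mod_in_residues_mod)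
  then show "weight e [t] (\<alpha> + from_coeffs e (\<lambda>_. n)) = weight e [t] \<alpha> + n"
    by (simp add: weight_single lookup_add lookup_from_coeffs[OF assms(1)] mod_in_residues_mod)
qed

text \<open>
  The bound on the interactions is what makes the integral sum m of the weights of the summands greater
  than -1. Adding to each summand a multiple of the null root moves all of m to the first summand and
  makes the other weights 0.
\<close>

lemma root_set_if_small_interaction:
  assumes e: "e > 0" and s: "s \<noteq> []"
    and A: "\<And>j. j < length s \<Longrightarrow> A j \<in> root_lattice e" "\<alpha> = (\<Sum>j<length s. A j)"
    and w: "weight e s \<alpha> \<ge> 0"
    and small: "(\<Sum>j<length s. \<Sum>k<length s. interaction e (s ! j) (s ! k) (A j - A k))
      < 4 * int (length s)"
  shows "\<alpha> \<in> root_set e s"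
proof -
  let ?r = "length s"
  define m where "m = (\<Sum>j<?r. weight e [s ! j] (A j))"
  have "0 \<le> 4 * weight e s \<alpha>" using w by simp
  also have "\<dots> < 4 * int ?r * (m + 1)"
    unfolding A(2) using weight_sum[OF e A(1)] small by (simp add: m_def algebra_simps)
  finally have "m \<ge> 0" by (simp add: zero_less_mult_iff)
  define u where "u = (\<lambda>j. (if j = 0 then m else 0) - weight e [s ! j] (A j))"
  define B where "B = (\<lambda>j. A j + from_coeffs e (\<lambda>_. u j))"
  have "B j \<in> root_lattice e \<and> weight e [s ! j] (B j) \<ge> 0" if "j < ?r" for j
    using weight_single_add_null_root(1)[OF e A(1)[OF that], of "u j"]
      weight_single_add_null_root(2)[OF e A(1)[OF that], where t = "s ! j" and n = "u j"] \<open>m \<ge> 0\<close>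
    by (simp add: B_def u_def del: carrier_free_Abelian_group_iff)
  moreover have "\<alpha> = (\<Sum>j<?r. B j)"
  proof (rule poly_mapping_eqI)
    fix i
    have "(\<Sum>j<?r. u j) = 0"
      using s by (simp add: u_def sum_subtractf m_def)
    then have "(\<Sum>j<?r. Poly_Mapping.lookup (from_coeffs e (\<lambda>_. u j)) i) = 0"
      by (cases "i \<in> residues_mod e") (simp_all add: lookup_from_coeffs[OF e])
    then show "Poly_Mapping.lookup \<alpha> i = Poly_Mapping.lookup (\<Sum>j<?r. B j) i"
      by (simp add: A(2) B_def lookup_sum lookup_add sum.distrib)
  qed
  ultimately show ?thesis unfolding root_set_iff_decomposition by blast
qed

section \<open>Balanced decompositions in small rank\<close>

lemma diff_square_sum_2:
  "diff_square_sum 2 \<alpha> = 2 * (Poly_Mapping.lookup \<alpha> 0 - Poly_Mapping.lookup \<alpha> 1)\<^sup>2"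
proof -
  have "{0..<int 2} = {0, 1}" by auto
  then show ?thesis
    by (simp add: diff_square_sum_pos residues_mod_pos power2_eq_square algebra_simps)
qed

lemma diff_square_sum_3:
  "diff_square_sum 3 \<alpha> = (Poly_Mapping.lookup \<alpha> 0 - Poly_Mapping.lookup \<alpha> 1)\<^sup>2
    + (Poly_Mapping.lookup \<alpha> 1 - Poly_Mapping.lookup \<alpha> 2)\<^sup>2
    + (Poly_Mapping.lookup \<alpha> 2 - Poly_Mapping.lookup \<alpha> 0)\<^sup>2"
proof -
  have "{0..<int 3} = {0, 1, 2}" by auto
  then show ?thesis by (simp add: diff_square_sum_pos residues_mod_pos)
qed

lemma diff_square_sum_two_valued:
  assumes "e \<in> {2, 3}" "x \<in> {1, - 1}" "\<And>i. Poly_Mapping.lookup \<gamma> i \<in> {0, x}"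
  shows "diff_square_sum e \<gamma> \<le> 2"
  using assms(1,2) assms(3)[of 0] assms(3)[of 1] assms(3)[of 2]
  by (auto simp: diff_square_sum_2 diff_square_sum_3)

lemma interaction_commute: "interaction e t s (\<beta> - \<alpha>) = interaction e s t (\<alpha> - \<beta>)"
proof -
  have "diff_square_sum e (\<beta> - \<alpha>) = diff_square_sum e (\<alpha> - \<beta>)"
    unfolding diff_square_sum_def Let_def
    by (intro sum.cong Collect_cong) (auto simp: lookup_minus power2_eq_square algebra_simps)
  then show ?thesis by (simp add: interaction_def lookup_minus)
qed

lemma interaction_same: "interaction e s t (\<alpha> - \<alpha>) = 0"
  by (simp add: interaction_def diff_square_sum_def)

text \<open>
  Halving \<alpha> and rounding all its coefficients in the same direction gives two summands whose
  difference is u or -u, where u is the reduction of \<alpha> modulo 2. For e \<le> 3 a vector with two adjacent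
  values has at most two neighbouring differences \<plusminus>1, so the quadratic part of the interaction is at
  most 2; the direction of rounding is chosen so that the linear part is not positive.
\<close>

lemma weight_nonneg_imp_root_set_two_components:
  assumes "e \<in> {2, 3}" "\<alpha> \<in> root_lattice e" "weight e [s, t] \<alpha> \<ge> 0"
  shows "\<alpha> \<in> root_set e [s, t]"
proof -
  have e: "e > 0" using assms(1) by auto
  define c where "c = Poly_Mapping.lookup \<alpha>"
  define u where "u = (\<lambda>i. c i mod 2)"
  define x :: int where "x = (if u (t mod int e) \<le> u (s mod int e) then 1 else - 1)"
  define \<beta> where "\<beta> = from_coeffs e (\<lambda>i. (c i + x * u i) div 2)"
  define A where "A = (\<lambda>j :: nat. if j = 0 then \<beta> else \<alpha> - \<beta>)"
  have twice: "2 * ((c i + x * u i) div 2) - c i = x * u i" for i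
    unfolding x_def u_def by (cases "even (c i)") (auto simp: elim!: evenE oddE)
  have *: "Poly_Mapping.lookup (\<beta> - (\<alpha> - \<beta>)) i = 2 * Poly_Mapping.lookup \<beta> i - c i" for i
    unfolding lookup_minus c_def by simp
  have \<gamma>: "Poly_Mapping.lookup (\<beta> - (\<alpha> - \<beta>)) i = x * u i" for i
  proof (cases "i \<in> residues_mod e")
    case True
    then show ?thesis
      using twice[of i] by (simp only: * ) (simp add: \<beta>_def lookup_from_coeffs[OF e])
  next
    case False
    then show ?thesis
      using lookup_zero_outside[OF assms(2) False]
      by (simp only: * ) (simp add: \<beta>_def lookup_from_coeffs[OF e] c_def u_def)
  qed
  have "x * (u (t mod int e) - u (s mod int e)) \<le> 0" by (simp add: x_def)
  moreover have "diff_square_sum e (\<beta> - (\<alpha> - \<beta>)) \<le> 2"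
  proof (rule diff_square_sum_two_valued[OF assms(1), of x])
    show "x \<in> {1, - 1}" by (simp add: x_def)
    show "Poly_Mapping.lookup (\<beta> - (\<alpha> - \<beta>)) i \<in> {0, x}" for i
      unfolding \<gamma> by (auto simp: u_def)
  qed
  ultimately have I: "interaction e s t (\<beta> - (\<alpha> - \<beta>)) \<le> 2"
    unfolding interaction_def \<gamma> right_diff_distrib by linarith
  have \<beta>: "\<beta> \<in> root_lattice e"
    unfolding \<beta>_def by (rule from_coeffs_in_root_lattice[OF e])
  have "\<alpha> - \<beta> \<in> root_lattice e"
    using assms(2) \<beta> keys_diff[of \<alpha> \<beta>] unfolding carrier_free_Abelian_group_iff by blast
  with \<beta> have "A j \<in> root_lattice e" for j
    unfolding A_def by presburger
  moreover have "\<alpha> = (\<Sum>j<length [s, t]. A j)"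
    by (simp add: A_def)
  moreover have "(\<Sum>j<length [s, t]. \<Sum>k<length [s, t].
      interaction e ([s, t] ! j) ([s, t] ! k) (A j - A k)) < 4 * int (length [s, t])"
    using I interaction_commute[of e t s "\<alpha> - \<beta>" \<beta>] interaction_same[of e s s \<beta>]
      interaction_same[of e t t "\<alpha> - \<beta>"] by (simp add: A_def)
  ultimately show ?thesis
    using root_set_if_small_interaction[OF e, of "[s, t]" A \<alpha>] assms(3) by simp
qed

text \<open>
  The three parts of d differ by at most 1. Two parts q + 1 and q contribute 0, 1 or 2, and they
  contribute 2 only if the larger part has z = 0 and the smaller one has z = 1; so the larger parts
  go to the indices with z = 1 as far as possible.
\<close>

lemma balanced_triple:
  fixes d z\<^sub>0 z\<^sub>1 z\<^sub>2 :: int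
  assumes "z\<^sub>0 \<in> {0, 1}" "z\<^sub>1 \<in> {0, 1}" "z\<^sub>2 \<in> {0, 1}"
  obtains d\<^sub>0 d\<^sub>1 d\<^sub>2 where "d\<^sub>0 + d\<^sub>1 + d\<^sub>2 = d"
    "(d\<^sub>0 - d\<^sub>1)\<^sup>2 + (d\<^sub>0 - d\<^sub>1) * (z\<^sub>1 - z\<^sub>0) + (d\<^sub>0 - d\<^sub>2)\<^sup>2 + (d\<^sub>0 - d\<^sub>2) * (z\<^sub>2 - z\<^sub>0)
      + (d\<^sub>1 - d\<^sub>2)\<^sup>2 + (d\<^sub>1 - d\<^sub>2) * (z\<^sub>2 - z\<^sub>1) \<le> 2"
proof -
  define q where "q = d div 3"
  have "d = 3 * q + d mod 3" by (simp add: q_def)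
  moreover have "d mod 3 \<in> {0, 1, 2}" by auto
  ultimately consider "d = 3 * q" | "d = 3 * q + 1" | "d = 3 * q + 2" by fastforce
  then show thesis
  proof cases
    case 1
    then show thesis using that[of q q q] by simp
  next
    case 2
    consider "z\<^sub>0 = 1 \<or> (z\<^sub>1 = 0 \<and> z\<^sub>2 = 0)" | "z\<^sub>0 = 0" "z\<^sub>1 = 1" | "z\<^sub>0 = 0" "z\<^sub>1 = 0" "z\<^sub>2 = 1"
      using assms by auto
    then show thesis
    proof cases
      case 1
      then show thesis using 2 assms that[of "q + 1" q q] by auto
    next
      case 2
      then show thesis using \<open>d = 3 * q + 1\<close> assms that[of q "q + 1" q] by auto
    next
      case 3
      then show thesis using \<open>d = 3 * q + 1\<close> that[of q q "q + 1"] by auto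
    qed
  next
    case 3
    consider "z\<^sub>0 = 0 \<or> (z\<^sub>1 = 1 \<and> z\<^sub>2 = 1)" | "z\<^sub>0 = 1" "z\<^sub>1 = 0" | "z\<^sub>0 = 1" "z\<^sub>1 = 1" "z\<^sub>2 = 0"
      using assms by auto
    then show thesis
    proof cases
      case 1
      then show thesis using 3 assms that[of q "q + 1" "q + 1"] by auto
    next
      case 2
      then show thesis using \<open>d = 3 * q + 2\<close> assms that[of "q + 1" q "q + 1"] by auto
    next
      case 3
      then show thesis using \<open>d = 3 * q + 2\<close> that[of "q + 1" "q + 1" q] by auto
    qed
  qed
qed

text \<open>
  For e = 2 the interactions depend only on the differences d of the two coefficients of the summands.
  The value z = 1 marks the components of even charge. The first summand takes the remaining multiple
  of the null root, which has no influence on the interactions.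
\<close>

lemma weight_nonneg_imp_root_set_three_components:
  assumes \<alpha>: "\<alpha> \<in> root_lattice 2" "weight 2 s \<alpha> \<ge> 0" and s: "length s = 3"
  shows "\<alpha> \<in> root_set 2 s"
proof -
  define c where "c = Poly_Mapping.lookup \<alpha>"
  define z where "z = (\<lambda>j. 1 - s ! j mod 2)"
  have z: "z j \<in> {0, 1}" for j by (auto simp: z_def)
  obtain d\<^sub>0 d\<^sub>1 d\<^sub>2 where d: "d\<^sub>0 + d\<^sub>1 + d\<^sub>2 = c 0 - c 1"
    "(d\<^sub>0 - d\<^sub>1)\<^sup>2 + (d\<^sub>0 - d\<^sub>1) * (z 1 - z 0) + (d\<^sub>0 - d\<^sub>2)\<^sup>2 + (d\<^sub>0 - d\<^sub>2) * (z 2 - z 0)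
      + (d\<^sub>1 - d\<^sub>2)\<^sup>2 + (d\<^sub>1 - d\<^sub>2) * (z 2 - z 1) \<le> 2"
    using balanced_triple[OF z z z] by metis
  define D where "D = (\<lambda>j. [d\<^sub>0, d\<^sub>1, d\<^sub>2] ! j)"
  define m where "m = (\<lambda>j :: nat. if j = 0 then c 1 else 0)"
  define A where "A = (\<lambda>j. from_coeffs 2 (\<lambda>i. if i = 0 then D j + m j else m j))"
  have res: "residues_mod 2 = {0, 1}" by (auto simp: residues_mod_pos)
  have A: "Poly_Mapping.lookup (A j) i = (if i = 0 then D j + m j else if i = 1 then m j else 0)" for i j
    by (simp add: A_def lookup_from_coeffs res)
  have I: "interaction 2 (s ! j) (s ! k) (A j - A k) =
      2 * ((D j - D k)\<^sup>2 + (D j - D k) * (z k - z j))" for j k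
  proof -
    have "s ! j mod 2 \<in> {0, 1}" "s ! k mod 2 \<in> {0, 1}" by auto
    then show ?thesis
      by (auto simp: interaction_def diff_square_sum_2 lookup_minus A z_def)
  qed
  show ?thesis
  proof (rule root_set_if_small_interaction[OF _ _ _ _ \<alpha>(2)])
    show "A j \<in> root_lattice 2" for j
      unfolding A_def by (rule from_coeffs_in_root_lattice) simp
    show "\<alpha> = (\<Sum>j<length s. A j)"
    proof (rule poly_mapping_eqI)
      fix i
      show "Poly_Mapping.lookup \<alpha> i = Poly_Mapping.lookup (\<Sum>j<length s. A j) i"
        using d(1) lookup_zero_outside[OF \<alpha>(1), of i]
        by (auto simp: s numeral_3_eq_3 lookup_sum lookup_add A D_def m_def res c_def)
    qed
    show "(\<Sum>j<length s. \<Sum>k<length s. interaction 2 (s ! j) (s ! k) (A j - A k)) < 4 * int (length s)"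
      unfolding I using d(2)
      by (simp add: s numeral_3_eq_3 numeral_2_eq_2 D_def power2_eq_square algebra_simps)
  qed (use s in auto)
qed

theorem theorem2:
  fixes r e :: nat and s :: "int list"
  assumes "r \<ge> 1"
    and "length s = r"
    and "r = 1 \<or> (r, e) \<in> {(2, 2), (2, 3), (3, 2)}"
  shows "root_set e s = {\<alpha> \<in> root_lattice e. weight e s \<alpha> \<ge> 0}"
proof (cases "r = 1")
  case True
  then obtain t where "s = [t]"
    using assms(2) by (auto simp: length_Suc_conv)
  then show ?thesis by (simp add: root_set_single_weight)
next
  case False
  with assms have e: "e > 0" and cases: "(length s = 2 \<and> e \<in> {2, 3}) \<or> (length s = 3 \<and> e = 2)"
    by auto
  have "\<alpha> \<in> root_set e s" if "\<alpha> \<in> root_lattice e" "weight e s \<alpha> \<ge> 0" for \<alpha>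
    using cases
  proof
    assume s: "length s = 2 \<and> e \<in> {2, 3}"
    then obtain t u where "s = [t, u]" by (auto simp: numeral_2_eq_2 length_Suc_conv)
    then show ?thesis using weight_nonneg_imp_root_set_two_components that s by blast
  next
    assume "length s = 3 \<and> e = 2"
    then show ?thesis using weight_nonneg_imp_root_set_three_components that by blast
  qed
  moreover have "\<alpha> \<in> root_lattice e" if "\<alpha> \<in> root_set e s" for \<alpha>
    using that root_of_in_root_lattice unfolding root_set_def by blast
  ultimately show ?thesis
    using weight_nonneg_of_root_set[OF e] by blast
qed

end
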